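(* Let $(\mathbf k,\log)$ be an ordered field with surjective logarithm, $(\mathbf k((G)),l)$ a series field with prelogarithmic section, $\psi$ a morphism from $(\mathbf k((G)),l)$ to itself, and $H\ne\{1\}$ a subgroup of $G$. Assume that $H$ satisfies the growth axiom, that $\psi^{EL}$ is surjective, that $(\psi^{EL})^{-1}(H)\subseteq H\cdot\mathrm{Exp}\,\mathbf k((H^{>1}))$, and that $l(H)\subseteq\mathbf k((\psi(H)))$. Then $L_0\subseteq L_1\subseteq L_2\subseteq\cdots$, and the union $LE(H;\psi):=\bigcup_mL_m$ is a subfield of $\mathbf k((G))^{EL}$ containing $\mathbf k((H))$ which is closed under $\mathrm{Exp}$, under $\mathrm{Log}$ (on its positive elements), and under $\psi^{EL}$.
   Context: Let $\mathbf k$ be an ordered field and $(G,\cdot,<)$ a totally ordered abelian group (written multiplicatively). $\mathbf k((G))$ denotes the field of generalized power series $\alpha=\sum_{g\in G}\alpha(g)\,g$ ($\alpha(g)\in\mathbf k$) with anti-well-ordered support, usual operations, canonical valuation $v(\alpha)=\max\operatorname{supp}\alpha$ and ordering $\alpha>0$ iff $\alpha(v(\alpha))>0$; $\mathbf k$, $G$ are identified with subsets of $\mathbf k((G))$. For $S\subseteq G$, $\mathbf k((S))=\{\alpha:\operatorname{supp}\alpha\subseteq S\}$. For a subgroup $H$ and $A\subseteq G$, $H^{>A}=\{h\in H:h>a\ \forall a\in A\}$, $H^{>1}=\{h\in H:h>1\}$. Every $\alpha>0$ is uniquely $\alpha=g\,a(1+\varepsilon)$ with $g=v(\alpha)$,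 $a\in\mathbf k^{>0}$, $\varepsilon\in\mathbf k((G^{<1}))$. A prelogarithmic section is an order-preserving group embedding $l:(G,\cdot)\to(\mathbf k((G^{>1})),+)$; the prelogarithm of $l$ is $L(g\,a(1+\varepsilon))=l(g)+\log a+\sum_{i\ge1}(-1)^{i-1}\varepsilon^i/i$. Exponential extension: $G^\#$ is the ordered abelian group of formal symbols $e(\alpha)$, $\alpha\in\mathbf k((G^{>1}))$, with $e(\alpha)e(\beta)=e(\alpha+\beta)$, $e(\alpha)<e(\beta)\iff\alpha<\beta$, and $e(l(g))$ identified with $g\in G$; $l^\#(e(\alpha))=\alpha$ is a prelogarithmic section of $\mathbf k((G^\#))$ extending $l$. Iterating: $G^{\#n}$, $l^{\#n}$, $L^{\#n}$. The EL-series field is $\mathbf k((G))^{EL}=\bigcup_n\mathbf k((G^{\#n}))$ with $\mathrm{Log}=\bigcup_nL^{\#n}$ and $\mathrm{Exp}=\mathrm{Log}^{-1}$. An order-preserving group embedding $\psi:G\to G$, extended to $\mathbf k((G))$ by $\psi(\sum a_gg)=\sum a_g\psi(g)$, is a morphism of $(\mathbf k((G)),l)$ to itself if $\psi\circ l=l\circ\psi$ on $G$; it induces $\psi^\#=(l^\#)^{-1}\circ\psi\circ l^\#$ on $G^\#$, iterates $\psi^{\#n}$, and $\psi^{EL}=\bigcup_n\psi^{\#n}$. $\psi^{(m)}$ is the $m$-fold composite of $\psi$. A subgroup $H\ne\{1\}$ of $G$ satisfies the growth axiom if $\mathrm{Log}(h)<|f|$ for all $h\in H$ and all nonzero $f\in\mathbf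 k((H^{>1}))$. LE construction: $G^{-1}_m=\{1\}$, $G^0_m=\psi^{(m)}(H)$, $G^{n+1}_m=G^n_m\cdot\mathrm{Exp}\,\mathbf k(((G^n_m)^{>G^{n-1}_m}))\subseteq G^{\#(n+1)}$; $\mathbf k^n_m=\mathbf k((G^n_m))$, $L_m=\bigcup_n\mathbf k^n_m$. *)

theory Defs
  imports Main
begin

text \<open>The value group is written additively: the paper's monomial g corresponds to
  the exponent g, the paper's 1 to 0, products of monomials to sums of exponents,
  and g > 1 (infinitely large monomial) to g > 0.  A series is a coefficient
  function from the ambient ordered group type 'g to the ordered field 'k.\<close>

type_synonym ('g, 'k) ser = "'g \<Rightarrow> 'k"

definition supp :: "('g, 'k::zero) ser \<Rightarrow> 'g set" where
  "supp f = {x. f x \<noteq> 0}"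

definition anti_wo :: "'g::linorder set \<Rightarrow> bool" where
  "anti_wo S \<longleftrightarrow> (\<forall>A. A \<subseteq> S \<longrightarrow> A \<noteq> {} \<longrightarrow> (\<exists>m\<in>A. \<forall>a\<in>A. a \<le> m))"

definition hs :: "'g::linorder set \<Rightarrow> ('g, 'k::zero) ser set" where
  "hs S = {f. supp f \<subseteq> S \<and> anti_wo (supp f)}"

definition hzero :: "('g, 'k::zero) ser" where "hzero = (\<lambda>x. 0)"
definition hconst :: "'k \<Rightarrow> ('g::zero, 'k::zero) ser" where
  "hconst c = (\<lambda>x. if x = 0 then c else 0)"
definition hone :: "('g::zero, 'k::{zero,one}) ser" where "hone = hconst 1"
definition mono :: "'g \<Rightarrow> ('g, 'k::{zero,one}) ser" where
  "mono g = (\<lambda>x. if x = g then 1 else 0)"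

definition hadd :: "('g, 'k::plus) ser \<Rightarrow> ('g, 'k) ser \<Rightarrow> ('g, 'k) ser" where
  "hadd f g = (\<lambda>x. f x + g x)"
definition hneg :: "('g, 'k::uminus) ser \<Rightarrow> ('g, 'k) ser" where
  "hneg f = (\<lambda>x. - f x)"
definition hsub :: "('g, 'k::minus) ser \<Rightarrow> ('g, 'k) ser \<Rightarrow> ('g, 'k) ser" where
  "hsub f g = (\<lambda>x. f x - g x)"
definition hscale :: "'k \<Rightarrow> ('g, 'k::times) ser \<Rightarrow> ('g, 'k) ser" where
  "hscale c f = (\<lambda>x. c * f x)"

text \<open>Cauchy product (the index set is finite for anti-well-ordered supports).\<close>
definition hmul :: "('g::plus, 'k::comm_semiring_1) ser \<Rightarrow> ('g, 'k) ser \<Rightarrow> ('g, 'k) ser" where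
  "hmul f g = (\<lambda>x. \<Sum>p\<in>{(a, b). f a \<noteq> 0 \<and> g b \<noteq> 0 \<and> a + b = x}. f (fst p) * g (snd p))"

primrec hpow :: "('g::{zero,plus}, 'k::comm_semiring_1) ser \<Rightarrow> nat \<Rightarrow> ('g, 'k) ser" where
  "hpow f 0 = hone"
| "hpow f (Suc n) = hmul f (hpow f n)"

text \<open>Sum of a summable family (each coefficient receives finitely many nonzero
  contributions).\<close>
definition hsum :: "('i \<Rightarrow> ('g, 'k::comm_monoid_add) ser) \<Rightarrow> 'i set \<Rightarrow> ('g, 'k) ser" where
  "hsum F I = (\<lambda>x. \<Sum>i\<in>{i\<in>I. F i x \<noteq> 0}. F i x)"

definition hv :: "('g::linorder, 'k::zero) ser \<Rightarrow> 'g" where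
  "hv f = (THE m. m \<in> supp f \<and> (\<forall>x\<in>supp f. x \<le> m))"

definition hpos :: "('g::linorder, 'k::linordered_field) ser \<Rightarrow> bool" where
  "hpos f \<longleftrightarrow> f \<noteq> hzero \<and> f (hv f) > 0"

definition hless :: "('g::linorder, 'k::linordered_field) ser \<Rightarrow> ('g, 'k) ser \<Rightarrow> bool" where
  "hless f g \<longleftrightarrow> hpos (hsub g f)"

definition habs :: "('g::linorder, 'k::linordered_field) ser \<Rightarrow> ('g, 'k) ser" where
  "habs f = (if hpos f then f else hneg f)"

text \<open>Extension of a map on exponents to series: sum a_g g |-> sum a_g phi(g).\<close>
definition push :: "('g \<Rightarrow> 'g) \<Rightarrow> ('g, 'k::zero) ser \<Rightarrow> ('g, 'k) ser" where
  "push \<phi> f = (\<lambda>y. if \<exists>x. f x \<noteq> 0 \<and> \<phi> x = y then f (SOME x. f x \<noteq> 0 \<and> \<phi> x = y) else 0)"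

definition add_subgroup :: "'g::ab_group_add set \<Rightarrow> bool" where
  "add_subgroup S \<longleftrightarrow> 0 \<in> S \<and> (\<forall>a\<in>S. \<forall>b\<in>S. a + b \<in> S) \<and> (\<forall>a\<in>S. - a \<in> S)"

definition pos_part :: "'g::{linorder,zero} set \<Rightarrow> 'g set" where
  "pos_part S = {x\<in>S. 0 < x}"

definition surj_klog :: "('k::linordered_field \<Rightarrow> 'k) \<Rightarrow> bool" where
  "surj_klog lg \<longleftrightarrow>
     (\<forall>a>0. \<forall>b>0. lg (a * b) = lg a + lg b) \<and>
     (\<forall>a>0. \<forall>b>0. a < b \<longrightarrow> lg a < lg b) \<and>
     lg ` {a. 0 < a} = UNIV"

definition prelog_section ::
  "'g::linordered_ab_group_add set \<Rightarrow> ('g \<Rightarrow> ('g, 'k::linordered_field) ser) \<Rightarrow> bool" where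
  "prelog_section G l \<longleftrightarrow> add_subgroup G \<and>
     (\<forall>g\<in>G. l g \<in> hs (pos_part G)) \<and>
     (\<forall>a\<in>G. \<forall>b\<in>G. l (a + b) = hadd (l a) (l b)) \<and>
     (\<forall>a\<in>G. \<forall>b\<in>G. a < b \<longrightarrow> hless (l a) (l b))"

text \<open>Realisation of the iterated exponential extensions inside one ambient ordered
  group 'g: Gam n plays the role of G^{#n} and l the role of the union of the
  sections l^{#n}.  The conditions say exactly that Gam (n+1), ordered by the
  ambient order, is identified via l with the ordered group (k((Gam n^{>1})),+)
  (i.e. Gam (n+1) = { e(alpha) }, e(alpha) e(beta) = e(alpha+beta),
  e(alpha) < e(beta) iff alpha < beta, l^{#(n+1)}(e(alpha)) = alpha), and that
  the element e(l^{#n}(g)) is identified with g in Gam n \<subseteq> Gam (n+1)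
  (which is automatic, l being one function).\<close>
definition EL_tower ::
  "'g::linordered_ab_group_add set \<Rightarrow> ('g \<Rightarrow> ('g, 'k::linordered_field) ser)
     \<Rightarrow> (nat \<Rightarrow> 'g set) \<Rightarrow> bool" where
  "EL_tower G l Gam \<longleftrightarrow> prelog_section G l \<and> Gam 0 = G \<and>
     (\<forall>n. add_subgroup (Gam n) \<and> Gam n \<subseteq> Gam (Suc n)) \<and>
     (\<forall>n. bij_betw l (Gam (Suc n)) (hs (pos_part (Gam n)))) \<and>
     (\<forall>n. \<forall>a\<in>Gam (Suc n). \<forall>b\<in>Gam (Suc n). l (a + b) = hadd (l a) (l b)) \<and>
     (\<forall>n. \<forall>a\<in>Gam (Suc n). \<forall>b\<in>Gam (Suc n). a < b \<longrightarrow> hless (l a) (l b))"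

definition UGam :: "(nat \<Rightarrow> 'g set) \<Rightarrow> 'g set" where
  "UGam Gam = (\<Union>n. Gam n)"

definition KEL :: "(nat \<Rightarrow> 'g::linorder set) \<Rightarrow> ('g, 'k::zero) ser set" where
  "KEL Gam = (\<Union>n. hs (Gam n))"

text \<open>The prelogarithm Log = union of the L^{#n}:
  alpha = g a (1 + eps), Log alpha = l(g) + log a + sum_{i>=1} (-1)^{i-1} eps^i / i.\<close>
definition Log ::
  "('k::linordered_field \<Rightarrow> 'k) \<Rightarrow> ('g::linordered_ab_group_add \<Rightarrow> ('g, 'k) ser)
     \<Rightarrow> ('g, 'k) ser \<Rightarrow> ('g, 'k) ser" where
  "Log klog l \<alpha> =
     (let g = hv \<alpha>; a = \<alpha> g;
          \<epsilon> = (\<lambda>x. if x = 0 then 0 else \<alpha> (x + g) / a)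
      in hadd (hadd (l g) (hconst (klog a)))
              (hsum (\<lambda>i. hscale ((- 1) ^ (i - 1) / of_nat i) (hpow \<epsilon> i)) {1..}))"

definition Exp ::
  "('k::linordered_field \<Rightarrow> 'k) \<Rightarrow> ('g::linordered_ab_group_add \<Rightarrow> ('g, 'k) ser)
     \<Rightarrow> (nat \<Rightarrow> 'g set) \<Rightarrow> ('g, 'k) ser \<Rightarrow> ('g, 'k) ser" where
  "Exp klog l Gam \<beta> = (THE \<alpha>. \<alpha> \<in> KEL Gam \<and> hpos \<alpha> \<and> Log klog l \<alpha> = \<beta>)"

definition growth_axiom ::
  "('k::linordered_field \<Rightarrow> 'k) \<Rightarrow> ('g::linordered_ab_group_add \<Rightarrow> ('g, 'k) ser)
     \<Rightarrow> 'g set \<Rightarrow> bool" where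
  "growth_axiom klog l H \<longleftrightarrow> H \<noteq> {0} \<and>
     (\<forall>h\<in>H. \<forall>f\<in>hs (pos_part H). f \<noteq> hzero \<longrightarrow>
        hless (Log klog l (mono h)) (habs f))"

definition morphism ::
  "'g::linordered_ab_group_add set \<Rightarrow> ('g \<Rightarrow> ('g, 'k::zero) ser) \<Rightarrow> ('g \<Rightarrow> 'g) \<Rightarrow> bool" where
  "morphism G l \<psi> \<longleftrightarrow> \<psi> ` G \<subseteq> G \<and>
     (\<forall>a\<in>G. \<forall>b\<in>G. \<psi> (a + b) = \<psi> a + \<psi> b) \<and>
     (\<forall>a\<in>G. \<forall>b\<in>G. a < b \<longrightarrow> \<psi> a < \<psi> b) \<and>
     (\<forall>g\<in>G. l (\<psi> g) = push \<psi> (l g))"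

primrec psi_lvl ::
  "('g \<Rightarrow> ('g, 'k::zero) ser) \<Rightarrow> (nat \<Rightarrow> 'g set) \<Rightarrow> ('g \<Rightarrow> 'g) \<Rightarrow> nat \<Rightarrow> 'g \<Rightarrow> 'g" where
  "psi_lvl l Gam \<psi> 0 = \<psi>"
| "psi_lvl l Gam \<psi> (Suc n) =
     (\<lambda>\<gamma>. THE \<gamma>'. \<gamma>' \<in> Gam (Suc n) \<and> l \<gamma>' = push (psi_lvl l Gam \<psi> n) (l \<gamma>))"

definition psiEL ::
  "('g \<Rightarrow> ('g, 'k::zero) ser) \<Rightarrow> (nat \<Rightarrow> 'g set) \<Rightarrow> ('g \<Rightarrow> 'g) \<Rightarrow> 'g \<Rightarrow> 'g" where
  "psiEL l Gam \<psi> \<gamma> = psi_lvl l Gam \<psi> (LEAST n. \<gamma> \<in> Gam n) \<gamma>"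

definition above :: "'g::linorder set \<Rightarrow> 'g set \<Rightarrow> 'g set" where
  "above A B = {h\<in>A. \<forall>b\<in>B. b < h}"

text \<open>Exp k((S)) as a set of group elements: for purely infinite series beta,
  Exp beta is the monomial e(beta), i.e. the group element with l-value beta.\<close>
definition ExpGrp ::
  "('g \<Rightarrow> ('g, 'k::zero) ser) \<Rightarrow> (nat \<Rightarrow> 'g::linorder set) \<Rightarrow> 'g set \<Rightarrow> 'g set" where
  "ExpGrp l Gam S = {c\<in>UGam Gam. l c \<in> hs S}"

definition setplus :: "'g::plus set \<Rightarrow> 'g set \<Rightarrow> 'g set" where
  "setplus A B = {a + b |a b. a \<in> A \<and> b \<in> B}"

text \<open>G^n_m for n >= 0 (with G^{-1}_m = {1}, i.e. {0} additively).\<close>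
fun GG ::
  "('g \<Rightarrow> ('g, 'k::zero) ser) \<Rightarrow> (nat \<Rightarrow> 'g::linordered_ab_group_add set) \<Rightarrow> ('g \<Rightarrow> 'g)
     \<Rightarrow> 'g set \<Rightarrow> nat \<Rightarrow> nat \<Rightarrow> 'g set" where
  "GG l Gam \<psi> H m 0 = (\<psi> ^^ m) ` H"
| "GG l Gam \<psi> H m (Suc 0) =
     setplus (GG l Gam \<psi> H m 0) (ExpGrp l Gam (above (GG l Gam \<psi> H m 0) {0}))"
| "GG l Gam \<psi> H m (Suc (Suc n)) =
     setplus (GG l Gam \<psi> H m (Suc n))
       (ExpGrp l Gam (above (GG l Gam \<psi> H m (Suc n)) (GG l Gam \<psi> H m n)))"

definition Lm ::
  "('g \<Rightarrow> ('g, 'k::zero) ser) \<Rightarrow> (nat \<Rightarrow> 'g::linordered_ab_group_add set) \<Rightarrow> ('g \<Rightarrow> 'g)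
     \<Rightarrow> 'g set \<Rightarrow> nat \<Rightarrow> ('g, 'k) ser set" where
  "Lm l Gam \<psi> H m = (\<Union>n. hs (GG l Gam \<psi> H m n))"

definition LE ::
  "('g \<Rightarrow> ('g, 'k::zero) ser) \<Rightarrow> (nat \<Rightarrow> 'g::linordered_ab_group_add set) \<Rightarrow> ('g \<Rightarrow> 'g)
     \<Rightarrow> 'g set \<Rightarrow> ('g, 'k) ser set" where
  "LE l Gam \<psi> H = (\<Union>m. Lm l Gam \<psi> H m)"

definition subfield_EL ::
  "(nat \<Rightarrow> 'g::linordered_ab_group_add set) \<Rightarrow> ('g, 'k::linordered_field) ser set \<Rightarrow> bool" where
  "subfield_EL Gam F \<longleftrightarrow> F \<subseteq> KEL Gam \<and> hzero \<in> F \<and> hone \<in> F \<and>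
     (\<forall>f\<in>F. \<forall>g\<in>F. hadd f g \<in> F \<and> hsub f g \<in> F \<and> hmul f g \<in> F) \<and>
     (\<forall>f\<in>F. f \<noteq> hzero \<longrightarrow> (\<exists>g\<in>F. hmul f g = hone))"

end

theory Submission
  imports Defs "HOL-Computational_Algebra.Formal_Power_Series" "HOL-Library.Infinite_Set"
begin

text \<open>Write G(n) for the groups built from H with m = 0. The endomorphism extends to an automorphism
  of the ordered group of all exponents that commutes with the section, and it carries the
  construction for m onto the one for m + 1; hence every inclusion need only be checked for m = 0.
  The growth axiom makes G(n) a convex subgroup of G(n+1). Therefore a purely infinite series over
  G(n) splits into pieces supported on the successive layers, so its exponential lies in G(n+1). The
  hypothesis on the preimage of H then propagates to the preimage of G(n) being contained in G(n+1),
  which is the inclusion of the m-th field in the next, and the hypothesis on the logarithms of H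
  gives closure under logarithms. The analytic input is Neumann's lemma: formal power series can be
  evaluated at infinitesimal series, compatibly with products and composition. This yields inverses
  and, from the formal identity between logarithm and exponential, the inverse of Log.\<close>

subsection \<open>Anti-well-ordered sets and Neumann's lemma\<close>

text \<open>The construction adjoins exponentials only of the fresh layer, the exponents above the
  whole previous group. The preimage of a fresh layer under \<Psi>, however, is only known to lie in
  the next group, not in one layer. This is the obstacle: exponentials of all purely infinite series
  have to be absorbed first, and convexity is what makes that possible. Convexity itself is read off
  through l, which preserves and reflects the order: y < e(c) iff l(y) < c. For H this is the growth
  axiom. It survives a step because an exponent above G(n) dominates both l of the exponential
  factor just added and any monomial of the old fresh layer, and such a monomial already dominates l
  of G(n). Raising m by one costs one step in n, both for the inclusion and for logarithms; the
  union over n absorbs the cost. \<open>Exp\<close> is a definite description over the whole EL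
  field, so an explicit preimage under \<open>Log\<close> is not enough: \<open>Log\<close> must
  also be injective on all positive elements of that field.\<close>

lemma anti_wo_subset: "anti_wo S \<Longrightarrow> T \<subseteq> S \<Longrightarrow> anti_wo T"
  unfolding anti_wo_def by blast

lemma anti_wo_iff_no_chain:
  "anti_wo S \<longleftrightarrow> \<not> (\<exists>s::nat \<Rightarrow> 'g::linorder. \<forall>n. s n \<in> S \<and> s n < s (Suc n))"
proof
  assume S: "anti_wo S"
  show "\<not> (\<exists>s. \<forall>n. s n \<in> S \<and> s n < s (Suc n))"
  proof
    assume "\<exists>s. \<forall>n. s n \<in> S \<and> s n < s (Suc n)"
    then obtain s where s: "\<And>n. s n \<in> S" "\<And>n. s n < s (Suc n)"
      by blast
    have "range s \<subseteq> S" "range s \<noteq> {}"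
      using s by auto
    then obtain m where "m \<in> range s" "\<forall>a\<in>range s. a \<le> m"
      using S unfolding anti_wo_def by blast
    then show False
      using s(2) by (auto simp: not_le[symmetric])
  qed
next
  assume no: "\<not> (\<exists>s. \<forall>n. s n \<in> S \<and> s n < s (Suc n))"
  show "anti_wo S"
    unfolding anti_wo_def
  proof (intro allI impI, rule ccontr)
    fix B assume B: "B \<subseteq> S" "B \<noteq> {}" "\<not> (\<exists>m\<in>B. \<forall>a\<in>B. a \<le> m)"
    have "\<exists>s. \<forall>n::nat. s n \<in> B \<and> s n < s (Suc n)"
      using dependent_nat_choice[of "\<lambda>_ x. x \<in> B" "\<lambda>_ x y. x < y"] B(2,3)
      by (auto simp: not_le)
    then show False
      using no B(1) by blast
  qed
qed

lemma anti_wo_no_chain: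
  "anti_wo S \<Longrightarrow> (\<And>n::nat. s n \<in> S) \<Longrightarrow> (\<And>n. s n < s (Suc n)) \<Longrightarrow> False"
  unfolding anti_wo_iff_no_chain by blast

text \<open>Every sequence has a monotone subsequence. If it increases, it attains its maximum,
  since the set is anti-well-ordered, and is constant from there on, so a tail is still
  non-increasing.\<close>

lemma anti_wo_subseq:
  fixes s :: "nat \<Rightarrow> 'g::linorder"
  assumes S: "anti_wo S" and s: "\<And>n. s n \<in> S"
  shows "\<exists>r::nat \<Rightarrow> nat. strict_mono r \<and> (\<forall>i j. i \<le> j \<longrightarrow> s (r j) \<le> s (r i))"
proof -
  obtain r where r: "strict_mono r" "monoseq (\<lambda>n. s (r n))"
    using seq_monosub by blast
  show ?thesis
  proof (cases "\<forall>m. \<forall>n\<ge>m. s (r n) \<le> s (r m)")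
    case True
    then show ?thesis
      using r(1) by blast
  next
    case False
    then have inc: "\<And>m n. m \<le> n \<Longrightarrow> s (r m) \<le> s (r n)"
      using r(2) unfolding monoseq_def by blast
    have "range (\<lambda>n. s (r n)) \<subseteq> S"
      using s by auto
    then obtain m where m: "m \<in> range (\<lambda>n. s (r n))" "\<forall>a\<in>range (\<lambda>n. s (r n)). a \<le> m"
      using S unfolding anti_wo_def by blast
    then obtain k where k: "m = s (r k)"
      by blast
    have const: "s (r (n + k)) = m" for n
      using m(2) k inc[of k "n + k"] by (auto intro!: antisym)
    have "strict_mono (\<lambda>n. r (n + k))"
      using r(1) by (auto simp: strict_mono_def)
    then show ?thesis
      using const by (intro exI[of _ "\<lambda>n. r (n + k)"]) simp
  qed
qed

lemma anti_wo_empty [simp]: "anti_wo {}"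
  by (simp add: anti_wo_def)

lemma anti_wo_singleton [simp]: "anti_wo {x}"
  by (auto simp: anti_wo_def subset_singleton_iff)

lemma anti_wo_Un: "anti_wo S \<Longrightarrow> anti_wo T \<Longrightarrow> anti_wo (S \<union> T)"
  unfolding anti_wo_def
proof (intro allI impI)
  fix A assume S: "\<forall>A\<subseteq>S. A \<noteq> {} \<longrightarrow> (\<exists>m\<in>A. \<forall>a\<in>A. a \<le> m)"
    and T: "\<forall>A\<subseteq>T. A \<noteq> {} \<longrightarrow> (\<exists>m\<in>A. \<forall>a\<in>A. a \<le> m)"
    and A: "A \<subseteq> S \<union> T" "A \<noteq> {}"
  show "\<exists>m\<in>A. \<forall>a\<in>A. a \<le> m"
  proof (cases "A \<inter> S = {} \<or> A \<inter> T = {}")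
    case True
    then have "A \<subseteq> S \<or> A \<subseteq> T"
      using A by blast
    then show ?thesis
      using S T A by blast
  next
    case False
    obtain m where m: "m \<in> A \<inter> S" "\<forall>a\<in>A \<inter> S. a \<le> m"
      using S False by (meson inf_le2)
    obtain n where n: "n \<in> A \<inter> T" "\<forall>a\<in>A \<inter> T. a \<le> n"
      using T False by (meson inf_le2)
    have "max m n \<in> A"
      using m n by (auto simp: max_def)
    moreover have "a \<le> max m n" if "a \<in> A" for a
      using that A m n by (auto simp: le_max_iff_disj)
    ultimately show ?thesis
      by blast
  qed
qed

lemma setplusI: "a \<in> S \<Longrightarrow> b \<in> T \<Longrightarrow> a + b \<in> setplus S T"
  by (auto simp: setplus_def)

text \<open>In an ascending chain of sums, pass to a subsequence whose first summands do not
  increase; the second summands then ascend strictly, which \<open>T\<close> forbids.\<close>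

lemma anti_wo_setplus:
  fixes S T :: "'g::linordered_ab_group_add set"
  assumes S: "anti_wo S" and T: "anti_wo T"
  shows "anti_wo (setplus S T)"
  unfolding anti_wo_iff_no_chain
proof
  assume "\<exists>s. \<forall>n::nat. s n \<in> setplus S T \<and> s n < s (Suc n)"
  then obtain s where s: "\<And>n. s n \<in> setplus S T" "\<And>n. s n < s (Suc n)"
    by blast
  have "\<forall>n. \<exists>a b. s n = a + b \<and> a \<in> S \<and> b \<in> T"
    using s(1) unfolding setplus_def by blast
  then obtain a b where ab: "\<And>n. s n = a n + b n" "\<And>n. a n \<in> S" "\<And>n. b n \<in> T"
    by metis
  obtain r :: "nat \<Rightarrow> nat" where r: "strict_mono r" "\<And>i j. i \<le> j \<Longrightarrow> a (r j) \<le> a (r i)"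
    using anti_wo_subseq[of S a, OF S ab(2)] by blast
  have "b (r n) < b (r (Suc n))" for n
  proof -
    have "s (r n) < s (r (Suc n))"
      using lift_Suc_mono_less[of s, OF s(2)] r(1) by (simp add: strict_mono_def)
    then show ?thesis
      using r(2)[of n "Suc n"] unfolding ab(1)
      by (meson add_mono leD leI lessI less_imp_le_nat)
  qed
  then show False
    using anti_wo_no_chain[of T "\<lambda>n. b (r n)"] T ab(3) by simp
qed

text \<open>Infinitely many decompositions would give distinct first summands that descend along a
  subsequence, hence second summands that ascend in \<open>T\<close>. This is what makes Cauchy
  products finite sums.\<close>

lemma finite_anti_wo_decompositions:
  fixes S T :: "'g::linordered_ab_group_add set"
  assumes S: "anti_wo S" and T: "anti_wo T"
  shows "finite {u. u \<in> S \<and> x - u \<in> T}"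
proof (rule ccontr)
  assume "infinite {u. u \<in> S \<and> x - u \<in> T}"
  then obtain f :: "nat \<Rightarrow> 'g" where f: "inj f" "range f \<subseteq> {u. u \<in> S \<and> x - u \<in> T}"
    by (meson infinite_countable_subset)
  have fS: "\<And>n. f n \<in> S" and fT: "\<And>n. x - f n \<in> T"
    using f(2) by auto
  obtain r :: "nat \<Rightarrow> nat" where r: "strict_mono r" "\<And>i j. i \<le> j \<Longrightarrow> f (r j) \<le> f (r i)"
    using anti_wo_subseq[of S f, OF S fS] by blast
  have "x - f (r n) < x - f (r (Suc n))" for n :: nat
  proof -
    have "r n \<noteq> r (Suc n)"
      using strict_monoD[OF r(1), of n "Suc n"] by simp
    then have "f (r n) \<noteq> f (r (Suc n))"
      using f(1) by (meson injD)
    then show ?thesis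
      using r(2)[of n "Suc n"] by simp
  qed
  then show False
    using anti_wo_no_chain[of T "\<lambda>n. x - f (r n)"] T fT by simp
qed

section \<open>Neumann's lemma on finite sums of negative exponents\<close>

primrec nfold :: "'g::ab_group_add set \<Rightarrow> nat \<Rightarrow> 'g set" where
  "nfold S 0 = {0}"
| "nfold S (Suc n) = setplus S (nfold S n)"

lemma nfold_nonpos:
  fixes S :: "'g::linordered_ab_group_add set"
  assumes "\<And>s. s \<in> S \<Longrightarrow> s < 0"
  shows "x \<in> nfold S n \<Longrightarrow> x \<le> 0" and "x \<in> nfold S (Suc n) \<Longrightarrow> x < 0"
proof -
  have le: "x \<in> nfold S n \<Longrightarrow> x \<le> 0" for x n
  proof (induction n arbitrary: x)
    case (Suc n)
    then obtain a b where "x = a + b" "a \<in> S" "b \<in> nfold S n"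
      by (auto simp: setplus_def)
    then show ?case
      using Suc.IH[of b] assms[of a] by (simp add: add_nonpos_nonpos)
  qed simp
  then show "x \<in> nfold S n \<Longrightarrow> x \<le> 0" .
  show "x < 0" if x: "x \<in> nfold S (Suc n)"
  proof -
    obtain a b where "x = a + b" "a \<in> S" "b \<in> nfold S n"
      using x by (auto simp: setplus_def)
    then show ?thesis
      using le[of b n] assms[of a] by (simp add: add_neg_nonpos)
  qed
qed

text \<open>Minimal bad sequence: among the points from which an infinite ascending chain starts, pick
  successively the ones with the fewest summands. Splitting off one summand from each and passing
  to a subsequence along which these summands do not increase gives a chain with fewer summands.\<close>

lemma no_nfold_chain:
  fixes S :: "'g::linordered_ab_group_add set" and x :: "nat \<Rightarrow> 'g" and n :: "nat \<Rightarrow> nat"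
  assumes S: "anti_wo S" and neg: "\<And>s. s \<in> S \<Longrightarrow> s < 0"
    and mem: "\<And>k. x k \<in> nfold S (n k)"
    and chain: "\<And>k. x k < x (Suc k) \<or> x k = x (Suc k) \<and> n k < n (Suc k)"
  shows False
proof -
  \<comment> \<open>Comparing value first and number of summands second treats two situations at
    once: ascending values, and one value reached with more and more summands.\<close>
  define lt :: "'g \<times> nat \<Rightarrow> 'g \<times> nat \<Rightarrow> bool"
    where "lt p q \<longleftrightarrow> fst p < fst q \<or> fst p = fst q \<and> snd p < snd q" for p q
  have lt_trans: "lt p q \<Longrightarrow> lt q r \<Longrightarrow> lt p r" for p q r
    by (auto simp: lt_def)
  define T where "T = {p. fst p \<in> nfold S (snd p)}"
  define B where "B = {p. \<exists>c. c 0 = p \<and> (\<forall>k::nat. c k \<in> T \<and> lt (c k) (c (Suc k)))}"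
  have BT: "p \<in> T" if "p \<in> B" for p
    using that by (auto simp: B_def)
  have Bstep: "\<exists>q\<in>B. lt p q" if p: "p \<in> B" for p
  proof -
    obtain c where c: "c 0 = p" "\<And>k::nat. c k \<in> T \<and> lt (c k) (c (Suc k))"
      using p unfolding B_def by auto
    have "c 1 \<in> B"
      unfolding B_def using c(2) by (auto intro!: exI[of _ "\<lambda>k. c (Suc k)"])
    then show ?thesis
      using c(1) c(2)[of 0] by auto
  qed
  have Bne: "(x 0, n 0) \<in> B"
    unfolding B_def using mem chain by (force simp: T_def lt_def intro!: exI[of _ "\<lambda>k. (x k, n k)"])
  have "\<exists>f. \<forall>k. (f k \<in> B \<and> (k = 0 \<longrightarrow> (\<forall>q\<in>B. snd (f k) \<le> snd q))) \<and>
      (lt (f k) (f (Suc k)) \<and> (\<forall>q\<in>B. lt (f k) q \<longrightarrow> snd (f (Suc k)) \<le> snd q))"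
  proof (rule dependent_nat_choice)
    show "\<exists>p. p \<in> B \<and> (0 = 0 \<longrightarrow> (\<forall>q\<in>B. snd p \<le> snd q))"
      using ex_has_least_nat[of "\<lambda>p. p \<in> B" _ snd] Bne by blast
  next
    fix p :: "'g \<times> nat" and k :: nat
    assume "p \<in> B \<and> (k = 0 \<longrightarrow> (\<forall>q\<in>B. snd p \<le> snd q))"
    then obtain q0 where "q0 \<in> B \<and> lt p q0"
      using Bstep by blast
    then show "\<exists>q. (q \<in> B \<and> (Suc k = 0 \<longrightarrow> (\<forall>q'\<in>B. snd q \<le> snd q'))) \<and>
        lt p q \<and> (\<forall>q'\<in>B. lt p q' \<longrightarrow> snd q \<le> snd q')"
      using ex_has_least_nat[of "\<lambda>q. q \<in> B \<and> lt p q" q0 snd] by blast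
  qed
  then obtain f where f0: "\<forall>k. (f k \<in> B \<and> (k = 0 \<longrightarrow> (\<forall>q\<in>B. snd (f k) \<le> snd q))) \<and>
      (lt (f k) (f (Suc k)) \<and> (\<forall>q\<in>B. lt (f k) q \<longrightarrow> snd (f (Suc k)) \<le> snd q))" ..
  then have f: "\<And>k. f k \<in> B" "\<And>k. lt (f k) (f (Suc k))"
    and min0: "\<And>q. q \<in> B \<Longrightarrow> snd (f 0) \<le> snd q"
    and minS: "\<And>k q. q \<in> B \<Longrightarrow> lt (f k) q \<Longrightarrow> snd (f (Suc k)) \<le> snd q"
    by simp_all
  have fT: "fst (f k) \<in> nfold S (snd (f k))" for k
    using BT[OF f(1)] by (simp add: T_def)
  \<comment> \<open>The empty sum has value 0. Its successor would need a positive value, or value 0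
    with at least one summand, but all summands are negative.\<close>
  have pos: "snd (f k) \<noteq> 0" for k
  proof
    assume 0: "snd (f k) = 0"
    then have "fst (f k) = 0"
      using fT[of k] by simp
    with f(2)[of k] 0 have "0 < fst (f (Suc k)) \<or> 0 = fst (f (Suc k)) \<and> 0 < snd (f (Suc k))"
      by (simp add: lt_def)
    then show False
    proof
      assume "0 < fst (f (Suc k))"
      then show False
        using nfold_nonpos(1)[OF neg fT[of "Suc k"]] by (simp add: leD)
    next
      assume a: "0 = fst (f (Suc k)) \<and> 0 < snd (f (Suc k))"
      then obtain j where "snd (f (Suc k)) = Suc j"
        by (metis gr0_implies_Suc)
      then show False
        using nfold_nonpos(2)[OF neg, where x = "fst (f (Suc k))" and n = j] fT[of "Suc k"] a by simp
    qed
  qed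
  have "\<exists>s y m. snd (f k) = Suc m \<and> fst (f k) = s + y \<and> s \<in> S \<and> y \<in> nfold S m" for k
  proof -
    obtain m where m: "snd (f k) = Suc m"
      using pos[of k] by (cases "snd (f k)") auto
    then show ?thesis
      using fT[of k] by (auto simp: setplus_def)
  qed
  then obtain s y m where sym: "\<And>k. snd (f k) = Suc (m k)" "\<And>k. fst (f k) = s k + y k"
    "\<And>k. s k \<in> S" "\<And>k. y k \<in> nfold S (m k)"
    by metis
  obtain r :: "nat \<Rightarrow> nat" where r: "strict_mono r" "\<And>i j. i \<le> j \<Longrightarrow> s (r j) \<le> s (r i)"
    using anti_wo_subseq[of S s, OF S sym(3)] by blast
  have f_lt: "lt (f i) (f j)" if "i < j" for i j
    using that
  proof (induction j)
    case (Suc j)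
    then show ?case
      using f(2)[of j] lt_trans by (cases "i = j") auto
  qed simp
  have ylt: "lt (y (r i), m (r i)) (y (r (Suc i)), m (r (Suc i)))" for i
  proof -
    have "lt (f (r i)) (f (r (Suc i)))"
      using f_lt r(1) by (simp add: strict_mono_def)
    moreover have le: "s (r (Suc i)) \<le> s (r i)"
      using r(2)[of i "Suc i"] by simp
    ultimately have "s (r i) + y (r i) < s (r (Suc i)) + y (r (Suc i)) \<or>
      s (r i) + y (r i) = s (r (Suc i)) + y (r (Suc i)) \<and> m (r i) < m (r (Suc i))"
      by (simp add: lt_def sym)
    then show ?thesis
    proof
      assume "s (r i) + y (r i) < s (r (Suc i)) + y (r (Suc i))"
      then have "y (r i) < y (r (Suc i))"
        using le by (meson add_mono leD leI)
      then show ?thesis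
        by (simp add: lt_def)
    next
      assume a: "s (r i) + y (r i) = s (r (Suc i)) + y (r (Suc i)) \<and> m (r i) < m (r (Suc i))"
      then have "y (r i) \<le> y (r (Suc i))"
        using le by (metis add_le_cancel_left add_le_cancel_right)
      then show ?thesis
        using a by (auto simp: lt_def)
    qed
  qed
  \<comment> \<open>Deleting the negative summand \<open>s (r 0)\<close> raises the value, so
    \<open>q\<close> lies above \<open>f (r 0)\<close> and hence above its predecessor in the
    sequence, if there is one. As \<open>q\<close> starts a chain and has fewer summands, it
    contradicts the minimal choice made at position \<open>r 0\<close>.\<close>
  define q where "q = (y (r 0), m (r 0))"
  have qB: "q \<in> B"
    unfolding B_def q_def
    using ylt sym(4) by (auto simp: T_def intro!: exI[of _ "\<lambda>i. (y (r i), m (r i))"])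
  have qlt: "lt (f (r 0)) q"
    using neg[OF sym(3)[of "r 0"]] by (simp add: lt_def q_def sym(2))
  have qlen: "snd q < snd (f (r 0))"
    by (simp add: q_def sym(1))
  show False
  proof (cases "r 0")
    case 0
    then show ?thesis
      using min0[OF qB] qlen by simp
  next
    case (Suc k)
    then show ?thesis
      using minS[OF qB, of k] lt_trans[OF f(2)[of k]] qlt qlen by simp
  qed
qed

lemma anti_wo_nfold_Union:
  fixes S :: "'g::linordered_ab_group_add set"
  assumes "anti_wo S" "\<And>s. s \<in> S \<Longrightarrow> s < 0"
  shows "anti_wo (\<Union>n. nfold S n)"
  unfolding anti_wo_iff_no_chain
proof
  assume "\<exists>x. \<forall>k::nat. x k \<in> (\<Union>n. nfold S n) \<and> x k < x (Suc k)"
  then obtain x where x: "\<And>k::nat. \<exists>n. x k \<in> nfold S n" "\<And>k. x k < x (Suc k)"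
    by auto
  then obtain n where "\<And>k. x k \<in> nfold S (n k)"
    by metis
  then show False
    using no_nfold_chain[OF assms, of x n] x(2) by simp
qed

text \<open>This is the second alternative in \<open>no_nfold_chain\<close>: the value stays
  constant while the number of summands grows. It makes a power series in an infinitesimal summable
  at each exponent.\<close>

lemma finite_nfold_multiplicity:
  fixes S :: "'g::linordered_ab_group_add set"
  assumes "anti_wo S" "\<And>s. s \<in> S \<Longrightarrow> s < 0"
  shows "finite {n. x \<in> nfold S n}"
proof (rule ccontr)
  assume inf: "infinite {n. x \<in> nfold S n}"
  let ?n = "Infinite_Set.enumerate {n. x \<in> nfold S n}"
  have "x \<in> nfold S (?n k)" for k
    using enumerate_in_set[OF inf] by simp
  moreover have "?n k < ?n (Suc k)" for k
    by (rule enumerate_step[OF inf])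
  ultimately show False
    using no_nfold_chain[OF assms, of "\<lambda>_. x" ?n] by simp
qed

subsection \<open>The ring of Hahn series\<close>

text \<open>The Cauchy product obeys the ring laws only for anti-well-ordered supports. Building
  this condition into a type makes series a \<open>comm_ring_1\<close>, so powers, finite sums and
  \<open>algebra_simps\<close> become available; \<open>coef\<close> and \<open>Hahn\<close>
  translate back to raw coefficient functions.\<close>

typedef (overloaded) ('g, 'k) hahn =
  "{f :: ('g::linordered_ab_group_add, 'k::comm_ring_1) ser. anti_wo (supp f)}"
  morphisms coef Hahn
  by (rule exI[of _ hzero]) (simp add: supp_def hzero_def)

lemma anti_wo_supp_coef: "anti_wo (supp (coef f))"
  using coef[of f] by simp

lemma coef_Hahn: "anti_wo (supp f) \<Longrightarrow> coef (Hahn f) = f"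
  by (simp add: Hahn_inverse)

lemma hahn_eqI: "(\<And>x. coef f x = coef g x) \<Longrightarrow> f = g"
  by (simp add: coef_inject[symmetric] fun_eq_iff)

text \<open>The freedom to enlarge the index set allows several products to be summed over one
  common finite set.\<close>

lemma hmul_eq_sum:
  fixes f g :: "('g::ab_group_add, 'k::comm_semiring_1) ser"
  assumes U: "finite U" "{u. f u \<noteq> 0 \<and> g (x - u) \<noteq> 0} \<subseteq> U"
  shows "hmul f g x = (\<Sum>u\<in>U. f u * g (x - u))"
proof -
  let ?V = "{u. f u \<noteq> 0 \<and> g (x - u) \<noteq> 0}"
  have "{(a, b). f a \<noteq> 0 \<and> g b \<noteq> 0 \<and> a + b = x} = (\<lambda>u. (u, x - u)) ` ?V"
    by (auto simp: image_iff)
  then have "hmul f g x = (\<Sum>u\<in>?V. f u * g (x - u))"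
    unfolding hmul_def by (simp add: sum.reindex inj_on_def)
  also have "\<dots> = (\<Sum>u\<in>U. f u * g (x - u))"
    by (rule sum.mono_neutral_left) (use U in auto)
  finally show ?thesis .
qed

lemma supp_hmul_subset: "supp (hmul f g) \<subseteq> setplus (supp f) (supp g)"
proof
  fix x assume "x \<in> supp (hmul f g)"
  then have "hmul f g x \<noteq> 0"
    by (simp add: supp_def)
  then have "{(a, b). f a \<noteq> 0 \<and> g b \<noteq> 0 \<and> a + b = x} \<noteq> {}"
    unfolding hmul_def by (metis sum.empty)
  then show "x \<in> setplus (supp f) (supp g)"
    by (auto simp: setplus_def supp_def)
qed

lemma supp_hadd_subset: "supp (hadd f (g :: ('g, 'k::monoid_add) ser)) \<subseteq> supp f \<union> supp g"
  by (auto simp: supp_def hadd_def)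

lemma supp_hsub_subset: "supp (hsub f (g :: ('g, 'k::group_add) ser)) \<subseteq> supp f \<union> supp g"
  by (auto simp: supp_def hsub_def)

lemma supp_hneg [simp]: "supp (hneg (f :: ('g, 'k::group_add) ser)) = supp f"
  by (auto simp: supp_def hneg_def)

lemma supp_hone_subset: "supp (hone :: ('g::zero, 'k::zero_neq_one) ser) \<subseteq> {0}"
  by (auto simp: supp_def hone_def hconst_def)

instantiation hahn :: (linordered_ab_group_add, comm_ring_1) comm_ring_1
begin

definition zero_hahn_def: "0 = Hahn hzero"
definition one_hahn_def: "1 = Hahn hone"
definition plus_hahn_def: "f + g = Hahn (hadd (coef f) (coef g))"
definition minus_hahn_def: "f - g = Hahn (hsub (coef f) (coef g))"
definition uminus_hahn_def: "- f = Hahn (hneg (coef f))"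
definition times_hahn_def: "f * g = Hahn (hmul (coef f) (coef g))"

lemma coef_0: "coef 0 x = 0"
  unfolding zero_hahn_def by (simp add: coef_Hahn supp_def hzero_def)

lemma coef_1: "coef (1 :: ('a, 'b) hahn) x = (if x = 0 then 1 else 0)"
proof -
  have "coef 1 = (hone :: ('a, 'b) ser)"
    unfolding one_hahn_def
    by (rule coef_Hahn) (rule anti_wo_subset[OF anti_wo_singleton supp_hone_subset])
  then show ?thesis
    by (simp add: hone_def hconst_def)
qed

lemma coef_add_fun: "coef (f + g) = hadd (coef f) (coef g)"
  unfolding plus_hahn_def
  by (simp add: coef_Hahn anti_wo_subset[OF anti_wo_Un supp_hadd_subset] anti_wo_supp_coef)

lemma coef_diff_fun: "coef (f - g) = hsub (coef f) (coef g)"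
  unfolding minus_hahn_def
  by (simp add: coef_Hahn anti_wo_subset[OF anti_wo_Un supp_hsub_subset] anti_wo_supp_coef)

lemma coef_minus_fun: "coef (- f) = hneg (coef f)"
  unfolding uminus_hahn_def by (simp add: coef_Hahn anti_wo_supp_coef)

lemma coef_mult_fun: "coef (f * g) = hmul (coef f) (coef g)"
  unfolding times_hahn_def
  by (simp add: coef_Hahn anti_wo_subset[OF anti_wo_setplus supp_hmul_subset] anti_wo_supp_coef)

lemma coef_add: "coef (f + g) x = coef f x + coef g x"
  by (simp add: coef_add_fun hadd_def)

lemma coef_diff: "coef (f - g) x = coef f x - coef g x"
  by (simp add: coef_diff_fun hsub_def)

lemma coef_minus: "coef (- f) x = - coef f x"
  by (simp add: coef_minus_fun hneg_def)

lemma coef_mult: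
  "finite U \<Longrightarrow> {u. coef f u \<noteq> 0 \<and> coef g (x - u) \<noteq> 0} \<subseteq> U \<Longrightarrow>
    coef (f * g) x = (\<Sum>u\<in>U. coef f u * coef g (x - u))"
  by (simp add: coef_mult_fun hmul_eq_sum)

lemma supp_coef_mult: "supp (coef (f * g)) \<subseteq> setplus (supp (coef f)) (supp (coef g))"
  by (simp add: coef_mult_fun supp_hmul_subset)

lemma hahn_mult_commute: "f * g = g * (f :: ('a, 'b) hahn)"
proof (rule hahn_eqI)
  fix x
  let ?U = "{u. u \<in> supp (coef f) \<and> x - u \<in> supp (coef g)}"
  have fin: "finite ?U"
    by (rule finite_anti_wo_decompositions[OF anti_wo_supp_coef anti_wo_supp_coef])
  have "coef (f * g) x = (\<Sum>u\<in>?U. coef f u * coef g (x - u))"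
    by (rule coef_mult[OF fin]) (auto simp: supp_def)
  also have "\<dots> = (\<Sum>w\<in>(\<lambda>u. x - u) ` ?U. coef g w * coef f (x - w))"
    by (subst sum.reindex) (auto simp: inj_on_def mult.commute)
  also have "\<dots> = coef (g * f) x"
  proof (rule coef_mult[symmetric])
    show "{u. coef g u \<noteq> 0 \<and> coef f (x - u) \<noteq> 0} \<subseteq> (\<lambda>u. x - u) ` ?U"
    proof
      fix w assume "w \<in> {u. coef g u \<noteq> 0 \<and> coef f (x - u) \<noteq> 0}"
      then show "w \<in> (\<lambda>u. x - u) ` ?U"
        by (intro image_eqI[of _ _ "x - w"]) (auto simp: supp_def)
    qed
  qed (use fin in simp)
  finally show "coef (f * g) x = coef (g * f) x" .
qed

lemma hahn_mult_assoc: "(f * g) * h = f * (g * (h :: ('a, 'b) hahn))"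
proof (rule hahn_eqI)
  fix x
  let ?F = "supp (coef f)" and ?G = "supp (coef g)" and ?H = "supp (coef h)"
  \<comment> \<open>The exponents taken from \<open>f\<close> and from \<open>h\<close> range over
    two fixed finite sets, and the exponent taken from \<open>g\<close> is then determined. Since
    neither range depends on the other index, the sums can be interchanged; the products are
    commuted so that \<open>h\<close> comes first.\<close>
  let ?U = "{u. u \<in> ?F \<and> x - u \<in> setplus ?G ?H}"
  let ?W = "{w. w \<in> ?H \<and> x - w \<in> setplus ?F ?G}"
  have fin: "finite ?U" "finite ?W"
    by (intro finite_anti_wo_decompositions anti_wo_setplus anti_wo_supp_coef)+
  have "coef ((f * g) * h) x = coef (h * (f * g)) x"
    by (simp only: hahn_mult_commute)
  also have "\<dots> = (\<Sum>w\<in>?W. coef h w * coef (f * g) (x - w))"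
    using supp_coef_mult[of f g] by (intro coef_mult fin) (auto simp: supp_def)
  also have "\<dots> = (\<Sum>w\<in>?W. \<Sum>u\<in>?U. coef h w * (coef f u * coef g (x - w - u)))"
  proof (rule sum.cong)
    fix w assume w: "w \<in> ?W"
    have "coef (f * g) (x - w) = (\<Sum>u\<in>?U. coef f u * coef g (x - w - u))"
    proof (rule coef_mult[OF fin(1)], safe)
      fix u assume "coef g (x - w - u) \<noteq> 0"
      then have "(x - w - u) + w \<in> setplus ?G ?H"
        using w by (intro setplusI) (auto simp: supp_def)
      then show "x - u \<in> setplus ?G ?H"
        by (simp add: algebra_simps)
    qed (auto simp: supp_def)
    then show "coef h w * coef (f * g) (x - w) = (\<Sum>u\<in>?U. coef h w * (coef f u * coef g (x - w - u)))"
      by (simp add: sum_distrib_left)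
  qed simp
  also have "\<dots> = (\<Sum>u\<in>?U. \<Sum>w\<in>?W. coef f u * (coef h w * coef g (x - u - w)))"
    by (subst sum.swap) (simp add: algebra_simps)
  also have "\<dots> = (\<Sum>u\<in>?U. coef f u * coef (h * g) (x - u))"
  proof (rule sum.cong)
    fix u assume u: "u \<in> ?U"
    have "coef (h * g) (x - u) = (\<Sum>w\<in>?W. coef h w * coef g (x - u - w))"
    proof (rule coef_mult[OF fin(2)], safe)
      fix w assume "coef g (x - u - w) \<noteq> 0"
      then have "u + (x - u - w) \<in> setplus ?F ?G"
        using u by (intro setplusI) (auto simp: supp_def)
      then show "x - w \<in> setplus ?F ?G"
        by (simp add: algebra_simps)
    qed (auto simp: supp_def)
    then show "(\<Sum>w\<in>?W. coef f u * (coef h w * coef g (x - u - w))) = coef f u * coef (h * g) (x - u)"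
      by (simp add: sum_distrib_left)
  qed simp
  also have "\<dots> = coef (f * (h * g)) x"
    using supp_coef_mult[of g h] unfolding hahn_mult_commute[of h g]
    by (intro coef_mult[symmetric] fin) (auto simp: supp_def)
  finally show "coef ((f * g) * h) x = coef (f * (g * h)) x"
    by (simp only: hahn_mult_commute[of g h])
qed

lemma hahn_distrib: "(f + g) * h = f * h + g * (h :: ('a, 'b) hahn)"
proof (rule hahn_eqI)
  fix x
  let ?U = "{u. u \<in> supp (coef f) \<union> supp (coef g) \<and> x - u \<in> supp (coef h)}"
  have fin: "finite ?U"
    by (intro finite_anti_wo_decompositions anti_wo_Un anti_wo_supp_coef)
  have "coef ((f + g) * h) x = (\<Sum>u\<in>?U. coef (f + g) u * coef h (x - u))"
    by (rule coef_mult[OF fin]) (auto simp: supp_def coef_add)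
  also have "\<dots> = (\<Sum>u\<in>?U. coef f u * coef h (x - u)) + (\<Sum>u\<in>?U. coef g u * coef h (x - u))"
    by (simp add: coef_add algebra_simps sum.distrib)
  also have "(\<Sum>u\<in>?U. coef f u * coef h (x - u)) = coef (f * h) x"
    by (rule coef_mult[OF fin, symmetric]) (auto simp: supp_def)
  also have "(\<Sum>u\<in>?U. coef g u * coef h (x - u)) = coef (g * h) x"
    by (rule coef_mult[OF fin, symmetric]) (auto simp: supp_def)
  finally show "coef ((f + g) * h) x = coef (f * h + g * h) x"
    by (simp add: coef_add)
qed

lemma hahn_mult_1: "1 * f = (f :: ('a, 'b) hahn)"
proof (rule hahn_eqI)
  fix x
  have "coef (1 * f) x = (\<Sum>u\<in>{0}. coef 1 u * coef f (x - u))"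
    by (rule coef_mult) (auto simp: coef_1)
  then show "coef (1 * f) x = coef f x"
    by (simp add: coef_1)
qed

instance
proof
  fix f g h :: "('a, 'b) hahn"
  show "f + g + h = f + (g + h)" "f + g = g + f" "0 + f = f" "- f + f = 0" "f - g = f + - g"
    by (rule hahn_eqI; simp add: coef_add coef_0 coef_minus coef_diff algebra_simps)+
  show "f * g * h = f * (g * h)"
    by (rule hahn_mult_assoc)
  show "f * g = g * f"
    by (rule hahn_mult_commute)
  show "1 * f = f"
    by (rule hahn_mult_1)
  show "(f + g) * h = f * h + g * h"
    by (rule hahn_distrib)
  show "(0 :: ('a, 'b) hahn) \<noteq> 1"
    by (metis coef_0 coef_1 zero_neq_one)
qed

end

lemma coef_0_fun: "coef 0 = hzero"
  by (simp add: fun_eq_iff coef_0 hzero_def)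

lemma coef_1_fun: "coef 1 = hone"
  by (simp add: fun_eq_iff coef_1 hone_def hconst_def)

lemma hpow_coef: "hpow (coef f) n = coef (f ^ n)"
  by (induction n) (simp_all add: coef_1_fun coef_mult_fun)

definition hmon :: "'k::comm_ring_1 \<Rightarrow> 'g::linordered_ab_group_add \<Rightarrow> ('g, 'k) hahn" where
  "hmon c g = Hahn (\<lambda>x. if x = g then c else 0)"

lemma coef_hmon: "coef (hmon c g) x = (if x = g then c else 0)"
proof -
  have "supp (\<lambda>x. if x = g then c else 0) \<subseteq> {g}"
    by (auto simp: supp_def)
  then show ?thesis
    unfolding hmon_def by (simp add: coef_Hahn anti_wo_subset[OF anti_wo_singleton])
qed

lemma coef_hmon_mult: "coef (hmon c g * f) x = c * coef f (x - g)"
proof -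
  have "coef (hmon c g * f) x = (\<Sum>u\<in>{g}. coef (hmon c g) u * coef f (x - u))"
    by (rule coef_mult) (auto simp: coef_hmon)
  then show ?thesis
    by (simp add: coef_hmon)
qed

lemma hmon_mult_hmon: "hmon c g * hmon d h = hmon (c * d) (g + h)"
  by (rule hahn_eqI) (auto simp: coef_hmon_mult coef_hmon algebra_simps)

lemma hmon_1_0: "hmon 1 0 = 1"
  by (rule hahn_eqI) (simp add: coef_hmon coef_1)

subsection \<open>Evaluation of formal power series at infinitesimal series\<close>

definition infinitesimal :: "('g::linordered_ab_group_add, 'k::comm_ring_1) hahn \<Rightarrow> bool" where
  "infinitesimal e \<longleftrightarrow> (\<forall>x\<in>supp (coef e). x < 0)"

text \<open>The index set does not depend on \<open>F\<close>, so additivity in \<open>F\<close> is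
  immediate. For infinitesimal \<open>e\<close> it is finite, by
  \<open>finite_nonzero_powers\<close>.\<close>

definition fps_eval ::
  "('g::linordered_ab_group_add, 'k::comm_ring_1) hahn \<Rightarrow> 'k fps \<Rightarrow> ('g, 'k) hahn" where
  "fps_eval e F = Hahn (\<lambda>x. \<Sum>n\<in>{n. coef (e ^ n) x \<noteq> 0}. fps_nth F n * coef (e ^ n) x)"

lemma supp_power_subset: "supp (coef (e ^ n)) \<subseteq> nfold (supp (coef e)) n"
proof (induction n)
  case 0
  then show ?case
    by (auto simp: supp_def coef_1 split: if_splits)
next
  case (Suc n)
  then show ?case
    using supp_coef_mult[of e "e ^ n"] by (fastforce simp: setplus_def)
qed

context
  fixes e :: "('g::linordered_ab_group_add, 'k::comm_ring_1) hahn"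
  assumes small: "infinitesimal e"
begin

lemma finite_nonzero_powers: "finite {n. coef (e ^ n) x \<noteq> 0}"
proof (rule finite_subset)
  show "{n. coef (e ^ n) x \<noteq> 0} \<subseteq> {n. x \<in> nfold (supp (coef e)) n}"
    using supp_power_subset[of e] by (auto simp: supp_def)
  show "finite {n. x \<in> nfold (supp (coef e)) n}"
    using small
    by (intro finite_nfold_multiplicity anti_wo_supp_coef) (auto simp: infinitesimal_def)
qed

text \<open>Over finitely many exponents at a time, evaluation is therefore evaluation of a
  truncated polynomial, and infinite sums never have to be rearranged.\<close>

lemma eventually_powers_vanish:
  assumes "finite X"
  shows "\<exists>N. \<forall>x\<in>X. \<forall>n\<ge>N. coef (e ^ n) x = 0"
proof -
  have "finite (\<Union>x\<in>X. {n. coef (e ^ n) x \<noteq> 0})"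
    using assms finite_nonzero_powers by auto
  then obtain N where "\<forall>n\<in>(\<Union>x\<in>X. {n. coef (e ^ n) x \<noteq> 0}). n < N"
    using finite_nat_set_iff_bounded by blast
  then show ?thesis
    by (intro exI[of _ N]) (auto simp: not_le[symmetric])
qed

lemma anti_wo_powers: "anti_wo (\<Union>n. nfold (supp (coef e)) n)"
  using small by (intro anti_wo_nfold_Union anti_wo_supp_coef) (auto simp: infinitesimal_def)

lemma coef_fps_eval_raw:
  "coef (fps_eval e F) = (\<lambda>x. \<Sum>n\<in>{n. coef (e ^ n) x \<noteq> 0}. fps_nth F n * coef (e ^ n) x)"
    (is "_ = ?f")
proof -
  have "supp ?f \<subseteq> (\<Union>n. nfold (supp (coef e)) n)"
  proof
    fix x assume "x \<in> supp ?f"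
    then have "{n. coef (e ^ n) x \<noteq> 0} \<noteq> {}"
      unfolding supp_def by (metis (mono_tags, lifting) mem_Collect_eq sum.empty)
    then show "x \<in> (\<Union>n. nfold (supp (coef e)) n)"
      using supp_power_subset[of e] by (auto simp: supp_def)
  qed
  then have "anti_wo (supp ?f)"
    using anti_wo_powers anti_wo_subset by blast
  then show ?thesis
    unfolding fps_eval_def by (rule coef_Hahn)
qed

lemma coef_fps_eval_superset:
  assumes "finite I" "\<And>n. fps_nth F n * coef (e ^ n) x \<noteq> 0 \<Longrightarrow> n \<in> I"
  shows "coef (fps_eval e F) x = (\<Sum>n\<in>I. fps_nth F n * coef (e ^ n) x)"
proof -
  let ?g = "\<lambda>n. fps_nth F n * coef (e ^ n) x"
  have "(\<Sum>n\<in>{n. coef (e ^ n) x \<noteq> 0}. ?g n) = (\<Sum>n\<in>I \<inter> {n. coef (e ^ n) x \<noteq> 0}. ?g n)"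
    using assms by (intro sum.mono_neutral_right finite_nonzero_powers) auto
  also have "\<dots> = (\<Sum>n\<in>I. ?g n)"
    using assms by (intro sum.mono_neutral_left) auto
  finally show ?thesis
    by (simp add: coef_fps_eval_raw)
qed

lemma coef_fps_eval:
  assumes "\<And>n. n \<ge> N \<Longrightarrow> coef (e ^ n) x = 0"
  shows "coef (fps_eval e F) x = (\<Sum>n<N. fps_nth F n * coef (e ^ n) x)"
  using assms by (intro coef_fps_eval_superset) (auto simp: not_le[symmetric])

lemma coef_fps_eval_nonzeroD:
  assumes "coef (fps_eval e F) x \<noteq> 0"
  obtains n where "fps_nth F n \<noteq> 0" "x \<in> nfold (supp (coef e)) n"
proof -
  have "\<exists>n. fps_nth F n * coef (e ^ n) x \<noteq> 0"
    using assms unfolding coef_fps_eval_raw by (meson sum.neutral)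
  then obtain n where "fps_nth F n * coef (e ^ n) x \<noteq> 0" ..
  then have "fps_nth F n \<noteq> 0" "coef (e ^ n) x \<noteq> 0"
    by (metis mult_zero_left, metis mult_zero_right)
  then show thesis
    using that[of n] supp_power_subset[of e n] by (auto simp: supp_def)
qed

lemma infinitesimal_fps_eval:
  assumes "fps_nth F 0 = 0"
  shows "infinitesimal (fps_eval e F)"
  unfolding infinitesimal_def
proof
  fix x assume "x \<in> supp (coef (fps_eval e F))"
  then have "coef (fps_eval e F) x \<noteq> 0"
    by (simp add: supp_def)
  then obtain n where n: "fps_nth F n \<noteq> 0" "x \<in> nfold (supp (coef e)) n"
    by (rule coef_fps_eval_nonzeroD)
  then obtain k where "n = Suc k"
    using assms by (metis not0_implies_Suc)
  then show "x < 0"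
    using nfold_nonpos(2)[of "supp (coef e)" x k] n small by (auto simp: infinitesimal_def)
qed

lemma fps_eval_mult: "fps_eval e (F * K) = fps_eval e F * fps_eval e K"
proof (rule hahn_eqI)
  fix x
  let ?M = "\<Union>n. nfold (supp (coef e)) n"
  let ?U = "{u. u \<in> ?M \<and> x - u \<in> ?M}"
  let ?p = "\<lambda>n. coef (e ^ n)"
  have fin: "finite ?U"
    by (rule finite_anti_wo_decompositions[OF anti_wo_powers anti_wo_powers])
  \<comment> \<open>One truncation bound is wanted for \<open>x\<close> and for every pair
    \<open>u\<close>, \<open>x - u\<close> that can contribute to the product at
    \<open>x\<close>.\<close>
  have "finite (insert x (?U \<union> (\<lambda>u. x - u) ` ?U))"
    using fin by simp
  from eventually_powers_vanish[OF this] obtain N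
    where N: "\<forall>y\<in>insert x (?U \<union> (\<lambda>u. x - u) ` ?U). \<forall>n\<ge>N. ?p n y = 0" ..
  have Nx: "?p n x = 0" if "n \<ge> N" for n
    using N that by simp
  have pow_mem: "?p n y \<noteq> 0 \<Longrightarrow> y \<in> ?M" for n y
    using supp_power_subset[of e n] by (auto simp: supp_def)
  have eval_mem: "coef (fps_eval e P) y \<noteq> 0 \<Longrightarrow> y \<in> ?M" for P y
    by (auto elim: coef_fps_eval_nonzeroD)
  have "coef (fps_eval e F * fps_eval e K) x
      = (\<Sum>u\<in>?U. coef (fps_eval e F) u * coef (fps_eval e K) (x - u))"
    by (rule coef_mult[OF fin]) (use eval_mem in blast)
  also have "\<dots> = (\<Sum>u\<in>?U. (\<Sum>i<N. fps_nth F i * ?p i u) * (\<Sum>j<N. fps_nth K j * ?p j (x - u)))"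
  proof (rule sum.cong)
    fix u assume "u \<in> ?U"
    then have "\<forall>n\<ge>N. ?p n u = 0" "\<forall>n\<ge>N. ?p n (x - u) = 0"
      using N by blast+
    then show "coef (fps_eval e F) u * coef (fps_eval e K) (x - u)
        = (\<Sum>i<N. fps_nth F i * ?p i u) * (\<Sum>j<N. fps_nth K j * ?p j (x - u))"
      using coef_fps_eval[of N] by simp
  qed simp
  also have "\<dots> = (\<Sum>u\<in>?U. \<Sum>i<N. \<Sum>j<N. fps_nth F i * fps_nth K j * (?p i u * ?p j (x - u)))"
    by (simp add: sum_product algebra_simps)
  also have "\<dots> = (\<Sum>i<N. \<Sum>u\<in>?U. \<Sum>j<N. fps_nth F i * fps_nth K j * (?p i u * ?p j (x - u)))"
    by (rule sum.swap)
  also have "\<dots> = (\<Sum>i<N. \<Sum>j<N. \<Sum>u\<in>?U. fps_nth F i * fps_nth K j * (?p i u * ?p j (x - u)))"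
    by (rule sum.cong[OF refl], rule sum.swap)
  also have "\<dots> = (\<Sum>i<N. \<Sum>j<N. fps_nth F i * fps_nth K j * ?p (i + j) x)"
  proof (intro sum.cong refl)
    fix i j
    have "?p (i + j) x = (\<Sum>u\<in>?U. ?p i u * ?p j (x - u))"
      unfolding power_add by (rule coef_mult[OF fin]) (use pow_mem in blast)
    then show "(\<Sum>u\<in>?U. fps_nth F i * fps_nth K j * (?p i u * ?p j (x - u)))
        = fps_nth F i * fps_nth K j * ?p (i + j) x"
      by (simp add: sum_distrib_left)
  qed
  also have "\<dots> = (\<Sum>(i, j)\<in>{..<N} \<times> {..<N}. fps_nth F i * fps_nth K j * ?p (i + j) x)"
    by (simp add: sum.cartesian_product)
  \<comment> \<open>The square shrinks to a triangle because the powers \<open>e ^ n\<close> with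
    \<open>n \<ge> N\<close> have coefficient 0 at \<open>x\<close>; the triangle is the Cauchy
    product of the formal series.\<close>
  also have "\<dots> = (\<Sum>(i, j)\<in>{(i, j). i + j < N}. fps_nth F i * fps_nth K j * ?p (i + j) x)"
  proof (rule sum.mono_neutral_right)
    show "\<forall>i\<in>{..<N} \<times> {..<N} - {(i, j). i + j < N}.
        (case i of (i, j) \<Rightarrow> fps_nth F i * fps_nth K j * ?p (i + j) x) = 0"
      by (intro ballI) (clarsimp simp: Nx not_less)
  qed auto
  also have "\<dots> = (\<Sum>n<N. \<Sum>i\<le>n. fps_nth F i * fps_nth K (n - i) * ?p n x)"
    by (subst sum.triangle_reindex) simp
  also have "\<dots> = (\<Sum>n<N. fps_nth (F * K) n * ?p n x)"
    by (simp add: fps_mult_nth sum_distrib_right atMost_atLeast0)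
  also have "\<dots> = coef (fps_eval e (F * K)) x"
    using Nx by (intro coef_fps_eval[symmetric]) auto
  finally show "coef (fps_eval e (F * K)) x = coef (fps_eval e F * fps_eval e K) x" ..
qed

lemma fps_eval_1: "fps_eval e 1 = 1"
proof (rule hahn_eqI)
  show "coef (fps_eval e 1) x = coef 1 x" for x
    by (subst coef_fps_eval_superset[of "{0}"]) (simp_all split: if_splits)
qed

lemma fps_eval_X: "fps_eval e fps_X = e"
proof (rule hahn_eqI)
  show "coef (fps_eval e fps_X) x = coef e x" for x
    by (subst coef_fps_eval_superset[of "{1}"]) (simp_all add: fps_X_def split: if_splits)
qed

lemma fps_eval_add: "fps_eval e (F + K) = fps_eval e F + fps_eval e K"
  by (rule hahn_eqI) (simp add: coef_add coef_fps_eval_raw algebra_simps sum.distrib)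

lemma fps_eval_power: "fps_eval e (F ^ n) = fps_eval e F ^ n"
  by (induction n) (simp_all add: fps_eval_1 fps_eval_mult)

lemma fps_eval_subset:
  assumes S: "add_subgroup S" and e: "supp (coef e) \<subseteq> S"
  shows "supp (coef (fps_eval e F)) \<subseteq> S"
proof
  have nf: "nfold (supp (coef e)) n \<subseteq> S" for n
  proof (induction n)
    case 0
    then show ?case
      using S by (simp add: add_subgroup_def)
  next
    case (Suc n)
    then show ?case
      using S e by (auto simp: add_subgroup_def setplus_def)
  qed
  fix x assume "x \<in> supp (coef (fps_eval e F))"
  then have "coef (fps_eval e F) x \<noteq> 0"
    by (simp add: supp_def)
  then obtain n where "x \<in> nfold (supp (coef e)) n"
    by (rule coef_fps_eval_nonzeroD)
  then show "x \<in> S"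
    using nf by blast
qed

end

text \<open>As \<open>A\<close> has no constant term, \<open>A ^ i\<close> starts in degree
  \<open>i\<close>. Hence a truncation bound for the powers of \<open>e\<close> at \<open>x\<close>
  also bounds the powers of \<open>fps_eval e A\<close> there, and both sides become the same finite
  double sum.\<close>

lemma fps_eval_compose:
  fixes e :: "('g::linordered_ab_group_add, 'k::idom) hahn"
  assumes small: "infinitesimal e" and A: "fps_nth A 0 = 0"
  shows "fps_eval e (F oo A) = fps_eval (fps_eval e A) F"
proof (rule hahn_eqI)
  fix x
  let ?p = "\<lambda>n. coef (e ^ n)"
  have "\<exists>N. \<forall>y\<in>{x}. \<forall>n\<ge>N. ?p n y = 0"
    by (rule eventually_powers_vanish[OF small]) simp
  then obtain N where N: "\<And>n. n \<ge> N \<Longrightarrow> ?p n x = 0"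
    by auto
  have low: "fps_nth (A ^ i) n = 0" if "n < i" for i n
    using startsby_zero_power_prefix[OF A, of i] that by simp
  have Ai: "coef (fps_eval e A ^ i) x = (\<Sum>n<N. fps_nth (A ^ i) n * ?p n x)" for i
    unfolding fps_eval_power[OF small, symmetric] by (rule coef_fps_eval[OF small N])
  have "coef (fps_eval e (F oo A)) x = (\<Sum>n<N. fps_nth (F oo A) n * ?p n x)"
    by (rule coef_fps_eval[OF small N])
  also have "\<dots> = (\<Sum>n<N. \<Sum>i<N. fps_nth F i * fps_nth (A ^ i) n * ?p n x)"
  proof (rule sum.cong)
    fix n assume n: "n \<in> {..<N}"
    have "fps_nth (F oo A) n = (\<Sum>i\<in>{0..n}. fps_nth F i * fps_nth (A ^ i) n)"
      by (simp add: fps_compose_nth)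
    also have "\<dots> = (\<Sum>i<N. fps_nth F i * fps_nth (A ^ i) n)"
      by (rule sum.mono_neutral_left) (use n low in auto)
    finally show "fps_nth (F oo A) n * ?p n x = (\<Sum>i<N. fps_nth F i * fps_nth (A ^ i) n * ?p n x)"
      by (simp add: sum_distrib_right)
  qed simp
  also have "\<dots> = (\<Sum>i<N. fps_nth F i * coef (fps_eval e A ^ i) x)"
    by (subst sum.swap) (simp add: Ai sum_distrib_left algebra_simps)
  also have "\<dots> = coef (fps_eval (fps_eval e A) F) x"
  proof (rule coef_fps_eval[symmetric, OF infinitesimal_fps_eval[OF small A]])
    fix i assume "N \<le> i"
    then show "coef (fps_eval e A ^ i) x = 0"
      by (simp add: Ai low)
  qed
  finally show "coef (fps_eval e (F oo A)) x = coef (fps_eval (fps_eval e A) F) x" .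
qed

subsection \<open>Subfields of series with restricted support\<close>

lemma hsE:
  assumes "f \<in> hs S"
  obtains F where "f = coef F" "supp (coef F) \<subseteq> S"
  using assms that[of "Hahn f"] coef_Hahn[of f] by (simp add: hs_def)

lemma coef_in_hs_iff: "coef F \<in> hs S \<longleftrightarrow> supp (coef F) \<subseteq> S"
  by (simp add: hs_def anti_wo_supp_coef)

lemma hs_mono: "S \<subseteq> T \<Longrightarrow> hs S \<subseteq> hs T"
  by (auto simp: hs_def)

lemma hzero_in_hs: "hzero \<in> hs S"
  by (simp add: hs_def supp_def hzero_def)

lemma hconst_in_hs: "0 \<in> S \<Longrightarrow> hconst c \<in> hs S"
  unfolding hs_def
  by (auto simp: supp_def hconst_def intro: anti_wo_subset[OF anti_wo_singleton[of 0]])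

lemma hadd_in_hs: "f \<in> hs S \<Longrightarrow> g \<in> hs S \<Longrightarrow> hadd f (g :: ('g::linorder, 'k::monoid_add) ser) \<in> hs S"
  using supp_hadd_subset[of f g] by (auto simp: hs_def intro: anti_wo_subset[OF anti_wo_Un])

lemma hsub_in_hs: "f \<in> hs S \<Longrightarrow> g \<in> hs S \<Longrightarrow> hsub f (g :: ('g::linorder, 'k::group_add) ser) \<in> hs S"
  using supp_hsub_subset[of f g] by (auto simp: hs_def intro: anti_wo_subset[OF anti_wo_Un])

lemma hneg_in_hs: "f \<in> hs S \<Longrightarrow> hneg (f :: ('g::linorder, 'k::group_add) ser) \<in> hs S"
  by (simp add: hs_def)

lemma supp_coef_mult_subgroup:
  "add_subgroup S \<Longrightarrow> supp (coef F) \<subseteq> S \<Longrightarrow> supp (coef K) \<subseteq> S \<Longrightarrow> supp (coef (F * K)) \<subseteq> S"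
  by (rule order_trans[OF supp_coef_mult]) (auto simp: add_subgroup_def setplus_def)

lemma hmul_in_hs:
  fixes f g :: "('g::linordered_ab_group_add, 'k::comm_ring_1) ser"
  assumes "add_subgroup S" "f \<in> hs S" "g \<in> hs S"
  shows "hmul f g \<in> hs S"
  using assms(2,3)
  by (elim hsE) (simp add: coef_mult_fun[symmetric] coef_in_hs_iff supp_coef_mult_subgroup[OF assms(1)])

text \<open>Used in two ways: to split a series into its purely infinite, constant and infinitesimal
  parts, and to separate the fresh layer of a purely infinite series from the rest.\<close>

definition hrestrict :: "'g set \<Rightarrow> ('g, 'k::zero) ser \<Rightarrow> ('g, 'k) ser" where
  "hrestrict A f = (\<lambda>x. if x \<in> A then f x else 0)"

lemma supp_hrestrict: "supp (hrestrict A f) = supp f \<inter> A"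
  by (auto simp: supp_def hrestrict_def)

lemma hrestrict_in_hs: "f \<in> hs S \<Longrightarrow> hrestrict A f \<in> hs (S \<inter> A)"
  unfolding hs_def by (auto simp: supp_hrestrict intro: anti_wo_subset)

section \<open>Leading exponents and positivity\<close>

lemma hv_eqI: "f m \<noteq> 0 \<Longrightarrow> (\<And>x. m < x \<Longrightarrow> f x = 0) \<Longrightarrow> hv f = m"
  unfolding hv_def by (rule the_equality) (force simp: supp_def not_less[symmetric])+

lemma hv_max:
  assumes "anti_wo (supp f)" "f \<noteq> hzero"
  shows "f (hv f) \<noteq> 0" "hv f < x \<Longrightarrow> f x = 0"
proof -
  have "supp f \<noteq> {}"
    using assms(2) by (auto simp: supp_def hzero_def)
  then obtain m where "m \<in> supp f" "\<forall>x\<in>supp f. x \<le> m"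
    using assms(1) unfolding anti_wo_def by blast
  then have m: "f m \<noteq> 0" "\<And>x. m < x \<Longrightarrow> f x = 0"
    by (auto simp: supp_def)
  then have "hv f = m"
    by (rule hv_eqI)
  then show "f (hv f) \<noteq> 0" "hv f < x \<Longrightarrow> f x = 0"
    using m by auto
qed

text \<open>Naming a witness for the leading exponent, here and in \<open>hposE\<close>, avoids
  handling the definite description in \<open>hv\<close>.\<close>

lemma hposI: "0 < f m \<Longrightarrow> (\<And>x. m < x \<Longrightarrow> f x = 0) \<Longrightarrow> hpos f"
  using hv_eqI[of f m] by (auto simp: hpos_def hzero_def)

lemma hposE:
  assumes "hpos f" "anti_wo (supp f)"
  obtains m where "0 < f m" "\<And>x. m < x \<Longrightarrow> f x = 0"
  using assms hv_max[of f] by (auto simp: hpos_def)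

lemma hpos_or_hpos_hneg: "anti_wo (supp f) \<Longrightarrow> f \<noteq> hzero \<Longrightarrow> hpos f \<or> hpos (hneg f)"
  using hv_max[of f] hposI[of f "hv f"] hposI[of "hneg f" "hv f"]
  by (cases "0 < f (hv f)") (auto simp: hneg_def)

lemma not_hpos_hzero: "\<not> hpos hzero"
  by (simp add: hpos_def)

lemma not_hpos_hneg:
  assumes "hpos f" "anti_wo (supp f)"
  shows "\<not> hpos (hneg f)"
proof
  assume "hpos (hneg f)"
  moreover have "anti_wo (supp (hneg f))"
    using assms by simp
  ultimately obtain n where n: "0 < hneg f n" "\<And>x. n < x \<Longrightarrow> hneg f x = 0"
    by (rule hposE) blast
  obtain m where m: "0 < f m" "\<And>x. m < x \<Longrightarrow> f x = 0"
    using assms by (rule hposE) blast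
  have "f n \<noteq> 0" "f m \<noteq> 0" "\<And>x. n < x \<Longrightarrow> f x = 0"
    using n m(1) by (auto simp: hneg_def)
  then have "m = n"
    using m(2) by (meson linorder_neqE)
  then show False
    using m(1) n(1) by (simp add: hneg_def)
qed

lemma hpos_hadd:
  assumes "hpos f" "anti_wo (supp f)" "hpos g" "anti_wo (supp g)"
  shows "hpos (hadd f g)"
proof -
  obtain m where m: "0 < f m" "\<And>x. m < x \<Longrightarrow> f x = 0"
    using assms(1,2) by (rule hposE) blast
  obtain n where n: "0 < g n" "\<And>x. n < x \<Longrightarrow> g x = 0"
    using assms(3,4) by (rule hposE) blast
  show ?thesis
  proof (rule hposI[of _ "max m n"])
    show "0 < hadd f g (max m n)"
      using m n by (cases m n rule: linorder_cases) (auto simp: hadd_def max_def)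
    show "hadd f g x = 0" if "max m n < x" for x
      using m n that by (auto simp: hadd_def)
  qed
qed

lemma add_subgroupD:
  assumes "add_subgroup S"
  shows "0 \<in> S" "a \<in> S \<Longrightarrow> b \<in> S \<Longrightarrow> a + b \<in> S" "a \<in> S \<Longrightarrow> - a \<in> S"
    "a \<in> S \<Longrightarrow> b \<in> S \<Longrightarrow> a - b \<in> S"
  using assms unfolding add_subgroup_def by (simp_all, metis add_uminus_conv_diff)

section \<open>Leading-term normal form and inverses\<close>

lemma infinitesimal_coef_0: "infinitesimal e \<Longrightarrow> 0 \<le> x \<Longrightarrow> coef e x = 0"
  by (force simp: infinitesimal_def supp_def)

lemma supp_coef_hmon: "g \<in> S \<Longrightarrow> supp (coef (hmon c g)) \<subseteq> S"
  by (auto simp: supp_def coef_hmon split: if_splits)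

lemma supp_coef_1: "0 \<in> S \<Longrightarrow> supp (coef 1) \<subseteq> S"
  by (auto simp: supp_def coef_1 split: if_splits)

lemma supp_coef_add_subset: "supp (coef F) \<subseteq> S \<Longrightarrow> supp (coef K) \<subseteq> S \<Longrightarrow> supp (coef (F + K)) \<subseteq> S"
  using supp_hadd_subset[of "coef F" "coef K"] by (simp add: coef_add_fun) blast

lemma supp_coef_diff_subset: "supp (coef F) \<subseteq> S \<Longrightarrow> supp (coef K) \<subseteq> S \<Longrightarrow> supp (coef (F - K)) \<subseteq> S"
  using supp_hsub_subset[of "coef F" "coef K"] by (simp add: coef_diff_fun) blast

text \<open>Division by the leading term leaves \<open>1 + e\<close>. The leading exponent lies in
  \<open>S\<close>, so for a subgroup \<open>S\<close> the quotient is still supported in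
  \<open>S\<close>.\<close>

lemma hahn_normal_form:
  fixes F :: "('g::linordered_ab_group_add, 'k::field) hahn"
  assumes F: "F \<noteq> 0" and S: "add_subgroup S" "supp (coef F) \<subseteq> S"
  obtains g a e where "F = hmon a g * (1 + e)" "g = hv (coef F)" "a = coef F g" "a \<noteq> 0" "g \<in> S"
    "infinitesimal e" "supp (coef e) \<subseteq> S"
proof -
  define g a e where "g = hv (coef F)" and "a = coef F g" and "e = hmon (1 / a) (- g) * F - 1"
  have "coef F \<noteq> hzero"
    using F by (metis coef_0_fun coef_inject)
  then have a: "a \<noteq> 0" and top: "\<And>x. g < x \<Longrightarrow> coef F x = 0"
    using hv_max[OF anti_wo_supp_coef, of F] by (auto simp: a_def g_def)
  have g: "g \<in> S"
    using a S by (auto simp: a_def supp_def)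
  have coef_e: "coef e x = (if x = 0 then 0 else coef F (x + g) / a)" for x
    using a by (simp add: e_def coef_diff coef_hmon_mult coef_1 a_def)
  have "infinitesimal e"
    unfolding infinitesimal_def
  proof
    fix x assume "x \<in> supp (coef e)"
    then have "x \<noteq> 0" "coef F (x + g) \<noteq> 0"
      by (auto simp: supp_def coef_e split: if_splits)
    then have "\<not> g < x + g"
      using top by blast
    then show "x < 0"
      using \<open>x \<noteq> 0\<close> by simp
  qed
  moreover have "supp (coef e) \<subseteq> S"
    unfolding e_def using S g add_subgroupD[OF S(1)]
    by (simp add: supp_coef_diff_subset supp_coef_mult_subgroup supp_coef_1 supp_coef_hmon)
  moreover have "hmon a g * (1 + e) = F"
  proof -
    have "hmon a g * (1 + e) = (hmon a g * hmon (1 / a) (- g)) * F"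
      by (simp add: e_def mult.assoc)
    also have "hmon a g * hmon (1 / a) (- g) = 1"
      using a by (simp add: hmon_mult_hmon hmon_1_0)
    finally show ?thesis
      by simp
  qed
  ultimately show thesis
    using that[of a g e] a g by (auto simp: a_def g_def)
qed

lemma coef_normal_form:
  "coef (hmon a g * (1 + e)) x = a * ((if x = g then 1 else 0) + coef e (x - g))"
  by (simp add: coef_hmon_mult coef_add coef_1)

lemma coef_normal_form_top:
  assumes "infinitesimal e"
  shows "coef (hmon a g * (1 + e)) g = a" "g < x \<Longrightarrow> coef (hmon a g * (1 + e)) x = 0"
  using infinitesimal_coef_0[OF assms] by (auto simp: coef_normal_form)

lemma hv_normal_form:
  assumes "infinitesimal e" "a \<noteq> 0"
  shows "hv (coef (hmon a g * (1 + e))) = g"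
  using coef_normal_form_top[OF assms(1)] assms(2) by (intro hv_eqI) auto

text \<open>After removal of the leading term the inverse is the geometric series, the formal
  inverse of \<open>1 + fps_X\<close> evaluated at \<open>e\<close>; evaluation does not leave the
  subgroup.\<close>

lemma hs_inverse:
  fixes f :: "('g::linordered_ab_group_add, 'k::field) ser"
  assumes S: "add_subgroup S" and f: "f \<in> hs S" "f \<noteq> hzero"
  shows "\<exists>g\<in>hs S. hmul f g = hone"
proof -
  obtain F where F: "f = coef F" "supp (coef F) \<subseteq> S"
    using f(1) by (rule hsE)
  have "F \<noteq> 0"
    using f(2) F(1) by (auto simp: coef_0_fun)
  then obtain g a e where nf: "F = hmon a g * (1 + e)" "a \<noteq> 0" "g \<in> S" "infinitesimal e"
    "supp (coef e) \<subseteq> S"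
    using S F(2) by (rule hahn_normal_form)
  let ?K = "fps_eval e (inverse (1 + fps_X))"
  have inv: "(1 + e) * ?K = 1"
  proof -
    have "(1 + fps_X) * inverse (1 + fps_X :: 'k fps) = 1"
      by (subst mult.commute) (simp add: inverse_mult_eq_1)
    then have "fps_eval e (1 + fps_X) * ?K = fps_eval e 1"
      by (simp only: fps_eval_mult[OF nf(4), symmetric])
    then show ?thesis
      by (simp add: fps_eval_add[OF nf(4)] fps_eval_1[OF nf(4)] fps_eval_X[OF nf(4)])
  qed
  have "F * (hmon (1 / a) (- g) * ?K) = (hmon a g * hmon (1 / a) (- g)) * ((1 + e) * ?K)"
    unfolding nf(1) by (simp only: mult_ac)
  also have "\<dots> = 1"
    using nf(2) by (simp add: inv hmon_mult_hmon hmon_1_0)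
  finally have "hmul f (coef (hmon (1 / a) (- g) * ?K)) = hone"
    by (simp add: F(1) coef_mult_fun[symmetric] coef_1_fun)
  moreover have "supp (coef (hmon (1 / a) (- g) * ?K)) \<subseteq> S"
    using S nf add_subgroupD(3)[OF S]
    by (simp add: supp_coef_mult_subgroup fps_eval_subset supp_coef_hmon)
  ultimately show ?thesis
    using coef_in_hs_iff by blast
qed

subsection \<open>Logarithm and exponential of series\<close>

text \<open>The series in \<open>Log\<close> is the formal log(1 + X), that is
  \<open>fps_ln 1\<close>, evaluated at \<open>e\<close>. Its constant term is 0, in agreement with
  a sum that starts at index 1.\<close>

lemma Log_normal_form:
  fixes e :: "('g::linordered_ab_group_add, 'k::linordered_field) hahn"
  assumes e: "infinitesimal e" and a: "a \<noteq> 0"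
  shows "Log klog l (coef (hmon a g * (1 + e))) =
    hadd (hadd (l g) (hconst (klog a))) (coef (fps_eval e (fps_ln 1)))"
proof -
  let ?F = "hmon a g * (1 + e)"
  have eps: "(\<lambda>x. if x = 0 then 0 else coef ?F (x + g) / a) = coef e"
    using a infinitesimal_coef_0[OF e, of 0] by (auto simp: fun_eq_iff coef_normal_form)
  have "hsum (\<lambda>i. hscale ((- 1) ^ (i - 1) / of_nat i) (hpow (coef e) i)) {1..}
      = coef (fps_eval e (fps_ln 1))"
  proof
    fix x
    let ?c = "\<lambda>i::nat. (- 1) ^ (i - 1) / of_nat i * coef (e ^ i) x"
    let ?I = "{i \<in> {1..}. ?c i \<noteq> 0}"
    have "finite ?I"
      by (rule finite_subset[OF _ finite_nonzero_powers[OF e, of x]]) auto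
    then have "coef (fps_eval e (fps_ln 1)) x = (\<Sum>i\<in>?I. fps_nth (fps_ln 1) i * coef (e ^ i) x)"
      by (rule coef_fps_eval_superset[OF e]) (auto simp: fps_ln_nth split: if_splits)
    also have "\<dots> = (\<Sum>i\<in>?I. ?c i)"
      by (rule sum.cong) (auto simp: fps_ln_nth)
    finally show "hsum (\<lambda>i. hscale ((- 1) ^ (i - 1) / of_nat i) (hpow (coef e) i)) {1..} x
        = coef (fps_eval e (fps_ln 1)) x"
      by (simp add: hsum_def hscale_def hpow_coef)
  qed
  then show ?thesis
    unfolding Log_def Let_def hv_normal_form[OF e a] coef_normal_form_top(1)[OF e] eps by simp
qed

lemma supp_mult_infinitesimal:
  assumes "supp (coef F) \<subseteq> {..w}" "infinitesimal e"
  shows "supp (coef (F * e)) \<subseteq> {..<w}"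
proof
  fix x assume "x \<in> supp (coef (F * e))"
  then obtain a b where "x = a + b" "a \<in> supp (coef F)" "b \<in> supp (coef e)"
    using supp_coef_mult[of F e] by (auto simp: setplus_def)
  then show "x \<in> {..<w}"
    using assms add_le_less_mono[of a w b 0] by (auto simp: infinitesimal_def)
qed

lemma infinitesimal_power_Suc: "infinitesimal e \<Longrightarrow> infinitesimal (e ^ Suc n)"
  using supp_power_subset[of e "Suc n"] nfold_nonpos(2)[of "supp (coef e)" _ n]
  unfolding infinitesimal_def by blast

text \<open>The logarithm is a perturbation of the identity: for i \<ge> 2, the support of the difference of
  i-th powers of d and e lies strictly below the leading exponent of e - d.\<close>

lemma fps_eval_ln_inj:
  fixes d e :: "('g::linordered_ab_group_add, 'k::field_char_0) hahn"
  assumes e: "infinitesimal e" and d: "infinitesimal d"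
    and eq: "fps_eval e (fps_ln 1) = fps_eval d (fps_ln 1)"
  shows "e = d"
proof (rule ccontr)
  assume "e \<noteq> d"
  then have nz: "coef (e - d) \<noteq> hzero"
    by (metis coef_0_fun coef_inject right_minus_eq)
  define w where "w = hv (coef (e - d))"
  have w: "coef (e - d) w \<noteq> 0" "\<And>x. w < x \<Longrightarrow> coef (e - d) x = 0"
    unfolding w_def using hv_max[OF anti_wo_supp_coef nz] by auto
  have le: "supp (coef (e - d)) \<subseteq> {..w}"
    using w(2) by (force simp: supp_def not_le[symmetric])
  have step: "supp (coef (e ^ Suc (Suc n) - d ^ Suc (Suc n))) \<subseteq> {..<w}" for n
  proof (induction n)
    case 0
    have "e ^ Suc (Suc 0) - d ^ Suc (Suc 0) = (e - d) * e + (e - d) * d"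
      by (simp add: algebra_simps)
    then show ?case
      using supp_mult_infinitesimal[OF le e] supp_mult_infinitesimal[OF le d]
        supp_coef_add_subset by metis
  next
    case (Suc n)
    have split: "e ^ Suc (Suc (Suc n)) - d ^ Suc (Suc (Suc n)) =
        (e - d) * e ^ Suc (Suc n) + (e ^ Suc (Suc n) - d ^ Suc (Suc n)) * d"
      by (simp add: algebra_simps)
    have "supp (coef (e ^ Suc (Suc n) - d ^ Suc (Suc n))) \<subseteq> {..w}"
      using Suc by (rule order_trans) auto
    then show ?case
      unfolding split
      by (intro supp_coef_add_subset supp_mult_infinitesimal le infinitesimal_power_Suc e d)
  qed
  have high: "coef (e ^ n) w = coef (d ^ n) w" if "2 \<le> n" for n
  proof -
    obtain k where "n = Suc (Suc k)"
      using \<open>2 \<le> n\<close> by (metis add_2_eq_Suc le_Suc_ex)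
    then have "coef (e ^ n - d ^ n) w = 0"
      using step[of k] by (auto simp: supp_def)
    then show ?thesis
      by (simp add: coef_diff)
  qed
  obtain N1 where N1: "\<forall>y\<in>{w}. \<forall>n\<ge>N1. coef (e ^ n) y = 0"
    using eventually_powers_vanish[OF e, of "{w}"] by auto
  obtain N2 where N2: "\<forall>y\<in>{w}. \<forall>n\<ge>N2. coef (d ^ n) y = 0"
    using eventually_powers_vanish[OF d, of "{w}"] by auto
  define N where "N = max 2 (max N1 N2)"
  let ?c = "fps_nth (fps_ln (1::'k))"
  have "coef (fps_eval e (fps_ln 1)) w = (\<Sum>n<N. ?c n * coef (e ^ n) w)"
    using N1 by (intro coef_fps_eval[OF e]) (simp add: N_def)
  moreover have "coef (fps_eval d (fps_ln 1)) w = (\<Sum>n<N. ?c n * coef (d ^ n) w)"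
    using N2 by (intro coef_fps_eval[OF d]) (simp add: N_def)
  ultimately have "0 = (\<Sum>n<N. ?c n * coef (e ^ n) w) - (\<Sum>n<N. ?c n * coef (d ^ n) w)"
    using eq by simp
  also have "\<dots> = (\<Sum>n<N. ?c n * (coef (e ^ n) w - coef (d ^ n) w))"
    by (simp add: sum_subtractf algebra_simps)
  \<comment> \<open>At the leading exponent \<open>w\<close> of \<open>e - d\<close> only the linear
    term survives: the powers of exponent 0 agree, and those from 2 on agree at \<open>w\<close> by
    \<open>high\<close>. The bound 2 in \<open>N\<close> keeps index 1 in range.\<close>
  also have "\<dots> = (\<Sum>n\<in>{1}. ?c n * (coef (e ^ n) w - coef (d ^ n) w))"
  proof (rule sum.mono_neutral_right)
    show "\<forall>n\<in>{..<N} - {1}. ?c n * (coef (e ^ n) w - coef (d ^ n) w) = 0"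
    proof
      fix n assume "n \<in> {..<N} - {1}"
      then have "n = 0 \<or> 2 \<le> n"
        by auto
      then show "?c n * (coef (e ^ n) w - coef (d ^ n) w) = 0"
        using high by auto
    qed
  qed (auto simp: N_def)
  also have "\<dots> = coef (e - d) w"
    by (simp add: fps_ln_nth coef_diff)
  finally show False
    using w(1) by simp
qed

text \<open>This supplies existence of an infinitesimal with a prescribed logarithm; uniqueness is
  \<open>fps_eval_ln_inj\<close>.\<close>

lemma fps_eval_ln_exp:
  fixes h :: "('g::linordered_ab_group_add, 'k::field_char_0) hahn"
  assumes h: "infinitesimal h"
  defines "e \<equiv> fps_eval h (fps_exp 1 - 1)"
  shows "infinitesimal e" "fps_eval e (fps_ln 1) = h"
proof -
  have 0: "fps_nth (fps_exp 1 - 1 :: 'k fps) 0 = 0"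
    by simp
  show "infinitesimal e"
    unfolding e_def by (rule infinitesimal_fps_eval[OF h 0])
  have "fps_ln 1 oo (fps_exp 1 - 1 :: 'k fps) = fps_X"
    by (subst fps_ln_fps_exp_inv) (auto intro!: fps_inv)
  then show "fps_eval e (fps_ln 1) = h"
    unfolding e_def by (simp add: fps_eval_compose[OF h 0, symmetric] fps_eval_X[OF h])
qed

lemma klog_inj: "surj_klog klog \<Longrightarrow> 0 < a \<Longrightarrow> 0 < b \<Longrightarrow> klog a = klog b \<Longrightarrow> a = b"
  unfolding surj_klog_def by (metis less_irrefl linorder_neqE_linordered_idom)

lemma hpos_coef_normal_form:
  fixes F :: "('g::linordered_ab_group_add, 'k::linordered_field) hahn"
  assumes "hpos (coef F)" "add_subgroup S" "supp (coef F) \<subseteq> S"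
  obtains a g e where "F = hmon a g * (1 + e)" "g = hv (coef F)" "0 < a" "g \<in> S"
    "infinitesimal e" "supp (coef e) \<subseteq> S"
proof -
  have "F \<noteq> 0"
    using assms(1) not_hpos_hzero by (auto simp: coef_0_fun)
  then obtain g a e where "F = hmon a g * (1 + e)" "g = hv (coef F)" "a = coef F g" "g \<in> S"
    "infinitesimal e" "supp (coef e) \<subseteq> S"
    using assms(2,3) by (rule hahn_normal_form) blast
  then show thesis
    using that[of a g e] assms(1) by (simp add: hpos_def)
qed

text \<open>The three summands of \<open>Log\<close> have disjoint supports: positive exponents for
  \<open>l g\<close>, exponent 0 for the constant, negative exponents for the series. Each can be
  read off and inverted separately.\<close>

lemma Log_inj:
  fixes f f' :: "('g::linordered_ab_group_add, 'k::linordered_field) ser"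
  assumes klog: "surj_klog klog" and S: "add_subgroup S"
    and l: "inj_on l S" "\<And>g. g \<in> S \<Longrightarrow> supp (l g) \<subseteq> {0<..}"
    and f: "f \<in> hs S" "hpos f" and f': "f' \<in> hs S" "hpos f'"
    and eq: "Log klog l f = Log klog l f'"
  shows "f = f'"
proof -
  obtain F where F: "f = coef F" "supp (coef F) \<subseteq> S"
    using f(1) by (rule hsE)
  obtain F' where F': "f' = coef F'" "supp (coef F') \<subseteq> S"
    using f'(1) by (rule hsE)
  obtain a g e where nf: "F = hmon a g * (1 + e)" "0 < a" "g \<in> S" "infinitesimal e"
    using f(2) S F(2) unfolding F(1) by (rule hpos_coef_normal_form)
  obtain a' g' e' where nf': "F' = hmon a' g' * (1 + e')" "0 < a'" "g' \<in> S" "infinitesimal e'"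
    using f'(2) S F'(2) unfolding F'(1) by (rule hpos_coef_normal_form)
  let ?h = "fps_eval e (fps_ln 1)" and ?h' = "fps_eval e' (fps_ln 1)"
  have inf: "infinitesimal ?h" "infinitesimal ?h'"
    using nf(4) nf'(4) by (simp_all add: infinitesimal_fps_eval)
  have sum_eq: "l g x + hconst (klog a) x + coef ?h x = l g' x + hconst (klog a') x + coef ?h' x" for x
  proof -
    have "hadd (hadd (l g) (hconst (klog a))) (coef ?h) = hadd (hadd (l g') (hconst (klog a'))) (coef ?h')"
      using eq nf(2) nf'(2) unfolding F(1) F'(1) nf(1) nf'(1)
      by (simp add: Log_normal_form[OF nf(4)] Log_normal_form[OF nf'(4)])
    then show ?thesis
      by (simp add: hadd_def fun_eq_iff)
  qed
  have l0: "l g x = 0" "l g' x = 0" if "x \<le> 0" for x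
    using l(2)[OF nf(3)] l(2)[OF nf'(3)] that by (auto simp: supp_def subset_iff not_le[symmetric])
  have "l g x = l g' x" for x
  proof (cases "x \<le> 0")
    case True
    then show ?thesis
      by (simp add: l0)
  next
    case False
    then show ?thesis
      using sum_eq[of x] by (auto simp: hconst_def infinitesimal_coef_0 inf split: if_splits)
  qed
  then have "g = g'"
    using l(1) nf(3) nf'(3) by (auto simp: fun_eq_iff dest: inj_onD)
  moreover have "klog a = klog a'"
    using sum_eq[of 0] by (simp add: hconst_def infinitesimal_coef_0 inf l0)
  then have "a = a'"
    using klog_inj[OF klog nf(2) nf'(2)] by simp
  moreover have "?h = ?h'"
  proof (rule hahn_eqI)
    fix x show "coef ?h x = coef ?h' x"
      using sum_eq[of x] by (cases "x < 0") (auto simp: hconst_def infinitesimal_coef_0 inf l0 split: if_splits)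
  qed
  then have "e = e'"
    by (rule fps_eval_ln_inj[OF nf(4) nf'(4)])
  ultimately show ?thesis
    by (simp add: F(1) F'(1) nf(1) nf'(1))
qed

text \<open>The constant and infinitesimal parts of \<open>f\<close> always have preimages, by
  surjectivity of \<open>klog\<close> and by exp(h) - 1. Only the purely infinite part depends on
  the group, so an element \<open>g\<close> of \<open>S\<close> realising it is assumed.\<close>

lemma Log_surj:
  fixes f :: "('g::linordered_ab_group_add, 'k::linordered_field) ser"
  assumes klog: "surj_klog klog" and S: "add_subgroup S"
    and f: "f \<in> hs S" and g: "g \<in> S" "l g = hrestrict {0<..} f"
  shows "\<exists>h\<in>hs S. hpos h \<and> Log klog l h = f"
proof -
  have "hrestrict {..<0} f \<in> hs (S \<inter> {..<0})"
    by (rule hrestrict_in_hs[OF f])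
  then obtain h where h: "hrestrict {..<0} f = coef h" "supp (coef h) \<subseteq> S \<inter> {..<0}"
    by (rule hsE)
  have inf: "infinitesimal h"
    using h(2) by (auto simp: infinitesimal_def)
  define e where "e = fps_eval h (fps_exp 1 - 1)"
  have e: "infinitesimal e" "fps_eval e (fps_ln 1) = h"
    unfolding e_def by (rule fps_eval_ln_exp[OF inf])+
  obtain a where a: "0 < a" "klog a = f 0"
    using klog unfolding surj_klog_def by (metis (mono_tags, lifting) UNIV_I imageE mem_Collect_eq)
  let ?F = "hmon a g * (1 + e)"
  have "supp (coef e) \<subseteq> S"
    unfolding e_def using h(2) by (intro fps_eval_subset[OF inf S]) auto
  then have "supp (coef ?F) \<subseteq> S"
    using g(1) add_subgroupD(1)[OF S]
    by (simp add: supp_coef_mult_subgroup[OF S] supp_coef_add_subset supp_coef_hmon supp_coef_1)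
  moreover have "hpos (coef ?F)"
    using coef_normal_form_top[OF e(1)] a(1) by (intro hposI[of _ g]) auto
  moreover have "Log klog l (coef ?F) = f"
  proof -
    have "Log klog l (coef ?F) = hadd (hadd (hrestrict {0<..} f) (hconst (f 0))) (hrestrict {..<0} f)"
      using a by (simp add: Log_normal_form[OF e(1)] e(2) g(2) h(1))
    also have "\<dots> = f"
      by (auto simp: fun_eq_iff hadd_def hrestrict_def hconst_def)
    finally show ?thesis .
  qed
  ultimately show ?thesis
    using coef_in_hs_iff by blast
qed

text \<open>Two groups occur because \<open>l\<close> need not keep supports inside
  \<open>S\<close>; only \<open>l g\<close> can lead out, while the constant and the series in
  \<open>e\<close> stay over \<open>S\<close>.\<close>

lemma Log_in_hs:
  fixes f :: "('g::linordered_ab_group_add, 'k::linordered_field) ser"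
  assumes S: "add_subgroup S" and f: "f \<in> hs S" "hpos f"
    and T: "S \<subseteq> T" "l ` S \<subseteq> hs T"
  shows "Log klog l f \<in> hs T"
proof -
  obtain F where F: "f = coef F" "supp (coef F) \<subseteq> S"
    using f(1) by (rule hsE)
  obtain a g e where nf: "F = hmon a g * (1 + e)" "0 < a" "g \<in> S" "infinitesimal e"
    "supp (coef e) \<subseteq> S"
    using f(2) S F(2) unfolding F(1) by (rule hpos_coef_normal_form)
  have "supp (coef (fps_eval e (fps_ln 1))) \<subseteq> T"
    using fps_eval_subset[OF nf(4) S nf(5)] T(1) by blast
  then show ?thesis
    unfolding F(1) nf(1) using nf(2,3) T add_subgroupD(1)[OF S]
    by (auto simp: Log_normal_form[OF nf(4)] coef_in_hs_iff intro!: hadd_in_hs hconst_in_hs)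
qed

subsection \<open>Pushing series forward along order embeddings\<close>

text \<open>The choice inside \<open>push\<close> selects a preimage with nonzero coefficient, so
  the equation holds for arbitrary \<open>\<phi>\<close>, before any injectivity is known.\<close>

lemma supp_push: "supp (push \<phi> f) = \<phi> ` supp f"
proof (rule set_eqI)
  fix y
  show "y \<in> supp (push \<phi> f) \<longleftrightarrow> y \<in> \<phi> ` supp f"
  proof (cases "\<exists>x. f x \<noteq> 0 \<and> \<phi> x = y")
    case True
    then have "f (SOME x. f x \<noteq> 0 \<and> \<phi> x = y) \<noteq> 0"
      using someI_ex[of "\<lambda>x. f x \<noteq> 0 \<and> \<phi> x = y"] by blast
    then show ?thesis
      using True by (auto simp: supp_def push_def)
  next
    case False
    then show ?thesis
      by (auto simp: supp_def push_def)
  qed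
qed

lemma push_apply:
  assumes "inj_on \<phi> S" "supp f \<subseteq> S" "x \<in> S"
  shows "push \<phi> f (\<phi> x) = f x"
proof (cases "f x = 0")
  case True
  have "\<phi> x \<notin> \<phi> ` supp f"
  proof
    assume "\<phi> x \<in> \<phi> ` supp f"
    then obtain z where "\<phi> x = \<phi> z" "z \<in> supp f"
      by blast
    then show False
      using assms True inj_onD[OF assms(1), of x z] by (auto simp: supp_def)
  qed
  then show ?thesis
    using True supp_push[of \<phi> f] by (auto simp: supp_def)
next
  case False
  have "(SOME z. f z \<noteq> 0 \<and> \<phi> z = \<phi> x) = x"
  proof (rule some_equality)
    fix z assume "f z \<noteq> 0 \<and> \<phi> z = \<phi> x"
    then show "z = x"
      using assms by (auto simp: supp_def dest: inj_onD)
  qed (use False in simp)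
  then show ?thesis
    using False by (auto simp: push_def)
qed

lemma push_notin: "supp f \<subseteq> S \<Longrightarrow> y \<notin> \<phi> ` S \<Longrightarrow> push \<phi> f y = 0"
  by (auto simp: push_def supp_def)

lemma push_cong:
  assumes "\<And>x. x \<in> supp f \<Longrightarrow> \<phi> x = \<phi>' x"
  shows "push \<phi> f = push \<phi>' f"
proof -
  have "(\<lambda>x. f x \<noteq> 0 \<and> \<phi> x = y) = (\<lambda>x. f x \<noteq> 0 \<and> \<phi>' x = y)" for y
    using assms by (auto simp: supp_def fun_eq_iff)
  then show ?thesis
    unfolding push_def by presburger
qed

lemma push_eqI:
  assumes "inj_on \<phi> S" "supp f \<subseteq> S"
    and "\<And>x. x \<in> S \<Longrightarrow> g (\<phi> x) = f x" "\<And>y. y \<notin> \<phi> ` S \<Longrightarrow> g y = 0"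
  shows "push \<phi> f = g"
proof
  fix y
  show "push \<phi> f y = g y"
  proof (cases "y \<in> \<phi> ` S")
    case True
    then show ?thesis
      using push_apply[OF assms(1,2)] assms(3) by auto
  next
    case False
    then show ?thesis
      using push_notin[OF assms(2)] assms(4) by simp
  qed
qed

lemma push_hadd:
  fixes f g :: "('g, 'k::monoid_add) ser"
  assumes "inj_on \<phi> S" "supp f \<subseteq> S" "supp g \<subseteq> S"
  shows "push \<phi> (hadd f g) = hadd (push \<phi> f) (push \<phi> g)"
proof (rule push_eqI[OF assms(1)])
  show "supp (hadd f g) \<subseteq> S"
    using supp_hadd_subset[of f g] assms by blast
  show "hadd (push \<phi> f) (push \<phi> g) (\<phi> x) = hadd f g x" if "x \<in> S" for x
    using that assms by (simp add: hadd_def push_apply)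
  show "hadd (push \<phi> f) (push \<phi> g) y = 0" if "y \<notin> \<phi> ` S" for y
    using that by (simp add: hadd_def push_notin[OF assms(2)] push_notin[OF assms(3)])
qed

lemma push_hsub:
  fixes f g :: "('g, 'k::group_add) ser"
  assumes "inj_on \<phi> S" "supp f \<subseteq> S" "supp g \<subseteq> S"
  shows "push \<phi> (hsub f g) = hsub (push \<phi> f) (push \<phi> g)"
proof (rule push_eqI[OF assms(1)])
  show "supp (hsub f g) \<subseteq> S"
    using supp_hsub_subset[of f g] assms by blast
  show "hsub (push \<phi> f) (push \<phi> g) (\<phi> x) = hsub f g x" if "x \<in> S" for x
    using that assms by (simp add: hsub_def push_apply)
  show "hsub (push \<phi> f) (push \<phi> g) y = 0" if "y \<notin> \<phi> ` S" for y
    using that by (simp add: hsub_def push_notin[OF assms(2)] push_notin[OF assms(3)])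
qed

lemma anti_wo_image:
  assumes "anti_wo T" "strict_mono_on T \<phi>"
  shows "anti_wo (\<phi> ` T)"
  unfolding anti_wo_def
proof (intro allI impI)
  fix A assume A: "A \<subseteq> \<phi> ` T" "A \<noteq> {}"
  then have "{x \<in> T. \<phi> x \<in> A} \<noteq> {}" "{x \<in> T. \<phi> x \<in> A} \<subseteq> T"
    by auto
  then obtain m where m: "m \<in> T" "\<phi> m \<in> A" "\<forall>x\<in>T. \<phi> x \<in> A \<longrightarrow> x \<le> m"
    using assms(1) unfolding anti_wo_def by (metis (mono_tags, lifting) mem_Collect_eq)
  have "a \<le> \<phi> m" if a: "a \<in> A" for a
  proof -
    obtain x where "x \<in> T" "a = \<phi> x"
      using A(1) a by blast
    then show ?thesis
      using m a assms(2) by (metis strict_mono_on_leD)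
  qed
  then show "\<exists>m\<in>A. \<forall>a\<in>A. a \<le> m"
    using m(2) by blast
qed

lemma push_in_hs:
  assumes "strict_mono_on S \<phi>" "f \<in> hs S"
  shows "push \<phi> f \<in> hs (\<phi> ` S)"
proof -
  have "supp f \<subseteq> S" "anti_wo (supp f)"
    using assms(2) by (auto simp: hs_def)
  moreover have "strict_mono_on (supp f) \<phi>"
    using assms(1) calculation(1) by (auto simp: monotone_on_def)
  ultimately show ?thesis
    by (auto simp: hs_def supp_push anti_wo_image)
qed

lemma hpos_push:
  assumes "strict_mono_on S \<phi>" "f \<in> hs S" "hpos f"
  shows "hpos (push \<phi> f)"
proof -
  have f: "supp f \<subseteq> S" "anti_wo (supp f)"
    using assms(2) by (auto simp: hs_def)
  obtain m where m: "0 < f m" "\<And>x. m < x \<Longrightarrow> f x = 0"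
    using assms(3) f(2) by (rule hposE) blast
  have mS: "m \<in> S"
    using m(1) f(1) by (auto simp: supp_def)
  have inj: "inj_on \<phi> S"
    using assms(1) by (rule strict_mono_on_imp_inj_on)
  show ?thesis
  proof (rule hposI)
    show "0 < push \<phi> f (\<phi> m)"
      using m(1) by (simp add: push_apply[OF inj f(1) mS])
    show "push \<phi> f y = 0" if y: "\<phi> m < y" for y
    proof (rule push_notin[OF order_refl], rule notI)
      assume "y \<in> \<phi> ` supp f"
      then obtain x where x: "x \<in> supp f" "y = \<phi> x"
        by blast
      then have "x \<le> m"
        using m(2)[of x] by (auto simp: supp_def not_less[symmetric])
      then have "y \<le> \<phi> m"
        using strict_mono_on_leD[OF assms(1), of x m] x f(1) mS by auto
      then show False
        using y by simp
    qed
  qed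
qed

lemma hless_push:
  assumes "strict_mono_on S \<phi>" "f \<in> hs S" "g \<in> hs S" "hless f g"
  shows "hless (push \<phi> f) (push \<phi> g)"
  using hpos_push[OF assms(1) hsub_in_hs[OF assms(3,2)]] assms(2-)
    push_hsub[OF strict_mono_on_imp_inj_on[OF assms(1)], of g f]
  by (simp add: hless_def hs_def)

lemma pos_part_mono: "A \<subseteq> B \<Longrightarrow> pos_part A \<subseteq> pos_part B"
  by (auto simp: pos_part_def)

lemma pos_part_eq_above: "pos_part A = above A {0}"
  by (auto simp: pos_part_def above_def)

lemma mono_in_hs: "u \<in> S \<Longrightarrow> mono u \<in> hs S"
  unfolding hs_def
  by (auto simp: supp_def mono_def intro: anti_wo_subset[OF anti_wo_singleton[of u]])

lemma hpos_mono: "hpos (mono u)"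
  by (rule hposI[of _ u]) (auto simp: mono_def)

lemma setplus_subgroup:
  assumes "add_subgroup A" "add_subgroup B"
  shows "add_subgroup (setplus A B)"
  unfolding add_subgroup_def
proof (intro conjI ballI)
  show "0 \<in> setplus A B"
    using setplusI[of 0 A 0 B] add_subgroupD(1) assms by auto
next
  fix x y assume "x \<in> setplus A B" "y \<in> setplus A B"
  then obtain a b a' b' where "x = a + b" "y = a' + b'" "a \<in> A" "b \<in> B" "a' \<in> A" "b' \<in> B"
    by (auto simp: setplus_def)
  then show "x + y \<in> setplus A B"
    using setplusI[of "a + a'" A "b + b'" B] add_subgroupD(2)[OF assms(1)] add_subgroupD(2)[OF assms(2)]
    by (simp add: algebra_simps)
next
  fix x assume "x \<in> setplus A B"
  then obtain a b where "x = a + b" "a \<in> A" "b \<in> B"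
    by (auto simp: setplus_def)
  then show "- x \<in> setplus A B"
    using setplusI[of "- a" A "- b" B] add_subgroupD(3)[OF assms(1)] add_subgroupD(3)[OF assms(2)]
    by (simp add: algebra_simps)
qed

subsection \<open>The exponential tower and its endomorphism\<close>

locale EL_morphism =
  fixes G :: "'g::linordered_ab_group_add set"
    and l :: "'g \<Rightarrow> ('g, 'k::linordered_field) ser"
    and Gam :: "nat \<Rightarrow> 'g set"
    and \<psi> :: "'g \<Rightarrow> 'g"
  assumes tower: "EL_tower G l Gam"
    and morph: "morphism G l \<psi>"
begin

abbreviation "U \<equiv> UGam Gam"

abbreviation "\<Psi> \<equiv> psiEL l Gam \<psi>"

lemma Gam_0: "Gam 0 = G"
  using tower by (simp add: EL_tower_def)

lemma Gam_subgroup: "add_subgroup (Gam n)"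
  using tower by (simp add: EL_tower_def)

lemma Gam_Suc: "Gam n \<subseteq> Gam (Suc n)"
  using tower by (simp add: EL_tower_def)

lemma Gam_mono: "m \<le> n \<Longrightarrow> Gam m \<subseteq> Gam n"
  by (rule lift_Suc_mono_le[of Gam]) (rule Gam_Suc)

lemma Gam_U: "Gam n \<subseteq> U"
  by (auto simp: UGam_def)

lemma U_common:
  assumes "a \<in> U" "b \<in> U"
  obtains n where "a \<in> Gam n" "b \<in> Gam n"
proof -
  obtain i j where "a \<in> Gam i" "b \<in> Gam j"
    using assms by (auto simp: UGam_def)
  then show thesis
    using that[of "max i j"] Gam_mono[of i "max i j"] Gam_mono[of j "max i j"] by auto
qed

lemma U_subgroup: "add_subgroup U"
  unfolding add_subgroup_def
proof (intro conjI ballI)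
  show "0 \<in> U"
    using add_subgroupD(1)[OF Gam_subgroup[of 0]] Gam_U by blast
  show "a + b \<in> U" if "a \<in> U" "b \<in> U" for a b
    using that by (rule U_common) (use add_subgroupD(2)[OF Gam_subgroup] Gam_U in blast)
  show "- a \<in> U" if "a \<in> U" for a
    using that add_subgroupD(3)[OF Gam_subgroup] by (auto simp: UGam_def)
qed

lemma l_add:
  assumes "a \<in> U" "b \<in> U"
  shows "l (a + b) = hadd (l a) (l b)"
proof -
  obtain n where "a \<in> Gam n" "b \<in> Gam n"
    using assms by (rule U_common)
  then have "a \<in> Gam (Suc n)" "b \<in> Gam (Suc n)"
    using Gam_Suc by blast+
  then show ?thesis
    using tower unfolding EL_tower_def by blast
qed

lemma l_less:
  assumes "a \<in> U" "b \<in> U" "a < b"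
  shows "hless (l a) (l b)"
proof -
  obtain n where "a \<in> Gam n" "b \<in> Gam n"
    using assms(1,2) by (rule U_common)
  then have "a \<in> Gam (Suc n)" "b \<in> Gam (Suc n)"
    using Gam_Suc by blast+
  then show ?thesis
    using tower assms(3) unfolding EL_tower_def by blast
qed

lemma l_bij: "bij_betw l (Gam (Suc n)) (hs (pos_part (Gam n)))"
  using tower by (simp add: EL_tower_def)

lemma l_Suc: "a \<in> Gam (Suc n) \<Longrightarrow> l a \<in> hs (pos_part (Gam n))"
  using l_bij[of n] by (auto simp: bij_betw_def)

lemma l_Gam: "a \<in> Gam n \<Longrightarrow> l a \<in> hs (pos_part (Gam n))"
  using l_Suc[of a n] Gam_Suc by blast

lemma l_U: "a \<in> U \<Longrightarrow> l a \<in> hs (pos_part U)"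
proof -
  assume "a \<in> U"
  then obtain n where "a \<in> Gam n"
    by (auto simp: UGam_def)
  then show ?thesis
    using l_Gam[of a n] hs_mono[OF pos_part_mono[OF Gam_U[of n]]] by blast
qed

lemma l_supp: "a \<in> U \<Longrightarrow> supp (l a) \<subseteq> U" "a \<in> U \<Longrightarrow> supp (l a) \<subseteq> {0<..}"
  using l_U[of a] by (auto simp: hs_def pos_part_def)

lemma l_surj: "f \<in> hs (pos_part (Gam n)) \<Longrightarrow> \<exists>c\<in>Gam (Suc n). l c = f"
  using l_bij[of n] by (force simp: bij_betw_def)

lemma l_inj: "inj_on l U"
proof (rule inj_onI)
  fix a b assume ab: "a \<in> U" "b \<in> U" "l a = l b"
  obtain n where "a \<in> Gam n" "b \<in> Gam n"
    using ab(1,2) by (rule U_common)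
  then have "a \<in> Gam (Suc n)" "b \<in> Gam (Suc n)"
    using Gam_Suc by blast+
  then show "a = b"
    using l_bij[of n] ab(3) by (auto simp: bij_betw_def dest: inj_onD)
qed

lemma l_0: "l 0 = hzero"
  using l_add[of 0 0] add_subgroupD(1)[OF U_subgroup] by (auto simp: hadd_def hzero_def fun_eq_iff)

lemma l_minus: "a \<in> U \<Longrightarrow> l (- a) = hneg (l a)"
  using l_add[of a "- a"] add_subgroupD(3)[OF U_subgroup] l_0
  by (auto simp: hadd_def hzero_def hneg_def fun_eq_iff eq_neg_iff_add_eq_0 add.commute)

lemma l_less_iff:
  assumes "a \<in> U" "b \<in> U"
  shows "hless (l a) (l b) \<longleftrightarrow> a < b"
proof
  assume less: "hless (l a) (l b)"
  show "a < b"
  proof (rule ccontr)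
    assume "\<not> a < b"
    then consider "a = b" | "b < a"
      by fastforce
    then show False
    proof cases
      case 1
      then have "hsub (l b) (l a) = hzero"
        by (simp add: hsub_def hzero_def)
      then show False
        using less not_hpos_hzero by (metis hless_def)
    next
      case 2
      then have "hpos (hsub (l a) (l b))"
        using l_less assms by (simp add: hless_def)
      moreover have "hneg (hsub (l a) (l b)) = hsub (l b) (l a)"
        by (simp add: hneg_def hsub_def)
      moreover have "anti_wo (supp (hsub (l a) (l b)))"
        using hsub_in_hs[OF l_U l_U] assms by (auto simp: hs_def)
      ultimately show False
        using less not_hpos_hneg by (metis hless_def)
    qed
  qed
qed (use assms l_less in blast)

section \<open>Lifting the morphism through the levels of the tower\<close>

abbreviation "lvl \<equiv> psi_lvl l Gam \<psi>"

text \<open>These properties must be carried through one induction: the definite description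
  defining the next level denotes something only if the present level is an order embedding.\<close>

definition lvl_embedding :: "nat \<Rightarrow> bool" where
  "lvl_embedding n \<longleftrightarrow> lvl n ` Gam n \<subseteq> Gam n \<and>
     (\<forall>a\<in>Gam n. \<forall>b\<in>Gam n. lvl n (a + b) = lvl n a + lvl n b) \<and>
     strict_mono_on (Gam n) (lvl n) \<and> (\<forall>a\<in>Gam n. l (lvl n a) = push (lvl n) (l a))"

text \<open>Pushing along an order embedding that fixes 0 keeps the support anti-well-ordered and
  positive, so the pushed series is an l-value on the next level; injectivity of \<open>l\<close>
  makes the element unique.\<close>

lemma lvl_Suc:
  assumes emb: "lvl_embedding n" and a: "a \<in> Gam (Suc n)"
  shows "lvl (Suc n) a \<in> Gam (Suc n)" "l (lvl (Suc n) a) = push (lvl n) (l a)"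
proof -
  have smono: "strict_mono_on (Gam n) (lvl n)"
    using emb by (simp add: lvl_embedding_def)
  have 0: "0 \<in> Gam n"
    by (rule add_subgroupD(1)[OF Gam_subgroup])
  have "lvl n (0 + 0) = lvl n 0 + lvl n 0"
    using emb 0 unfolding lvl_embedding_def by blast
  then have "lvl n 0 = 0"
    by simp
  then have "lvl n ` pos_part (Gam n) \<subseteq> pos_part (Gam n)"
    using emb strict_mono_onD[OF smono 0] by (fastforce simp: pos_part_def lvl_embedding_def)
  moreover have "push (lvl n) (l a) \<in> hs (lvl n ` pos_part (Gam n))"
    using smono l_Suc[OF a] by (intro push_in_hs) (auto simp: monotone_on_def pos_part_def)
  ultimately have "push (lvl n) (l a) \<in> hs (pos_part (Gam n))"
    using hs_mono by blast
  then obtain c where c: "c \<in> Gam (Suc n)" "l c = push (lvl n) (l a)"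
    using l_surj by blast
  have "lvl (Suc n) a = c"
    unfolding psi_lvl.simps
  proof (rule the_equality)
    show "c' = c" if "c' \<in> Gam (Suc n) \<and> l c' = push (lvl n) (l a)" for c'
      using that c inj_onD[OF l_inj, of c' c] Gam_U by auto
  qed (use c in simp)
  then show "lvl (Suc n) a \<in> Gam (Suc n)" "l (lvl (Suc n) a) = push (lvl n) (l a)"
    using c by simp_all
qed

text \<open>Both sides have the l-value \<open>push (lvl n) (l a)\<close>, one by construction and
  the other by compatibility with \<open>l\<close>.\<close>

lemma lvl_extends:
  assumes emb: "lvl_embedding n" and a: "a \<in> Gam n"
  shows "lvl (Suc n) a = lvl n a"
proof (rule inj_onD[OF l_inj])
  have a': "a \<in> Gam (Suc n)"
    using a Gam_Suc by blast
  show "l (lvl (Suc n) a) = l (lvl n a)"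
    using lvl_Suc(2)[OF emb a'] emb a by (simp add: lvl_embedding_def)
  show "lvl (Suc n) a \<in> U"
    using lvl_Suc(1)[OF emb a'] Gam_U by blast
  show "lvl n a \<in> U"
    using emb a Gam_U by (auto simp: lvl_embedding_def)
qed

lemma lvl_embedding: "lvl_embedding n"
proof (induction n)
  case 0
  show ?case
    using morph unfolding lvl_embedding_def morphism_def Gam_0 by (simp add: monotone_on_def)
next
  case (Suc n)
  note lvl = lvl_Suc[OF Suc]
  have smono: "strict_mono_on (Gam n) (lvl n)"
    using Suc by (simp add: lvl_embedding_def)
  have l_hs: "l a \<in> hs (Gam n)" if "a \<in> Gam (Suc n)" for a
    using l_Suc[OF that] hs_mono[of "pos_part (Gam n)" "Gam n"] by (auto simp: pos_part_def)
  show ?case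
    unfolding lvl_embedding_def
  proof (intro conjI ballI)
    show "lvl (Suc n) ` Gam (Suc n) \<subseteq> Gam (Suc n)"
      using lvl(1) by blast
  next
    fix a b assume ab: "a \<in> Gam (Suc n)" "b \<in> Gam (Suc n)"
    note sub = add_subgroupD(2)[OF Gam_subgroup[of "Suc n"]]
    have U: "lvl (Suc n) a \<in> U" "lvl (Suc n) b \<in> U" "a \<in> U" "b \<in> U"
      using lvl(1) ab Gam_U by blast+
    show "lvl (Suc n) (a + b) = lvl (Suc n) a + lvl (Suc n) b"
    proof (rule inj_onD[OF l_inj])
      have "l (lvl (Suc n) (a + b)) = push (lvl n) (hadd (l a) (l b))"
        using lvl(2)[OF sub[OF ab]] l_add U by simp
      also have "\<dots> = hadd (push (lvl n) (l a)) (push (lvl n) (l b))"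
        using l_hs[OF ab(1)] l_hs[OF ab(2)]
        by (intro push_hadd[OF strict_mono_on_imp_inj_on[OF smono]]) (auto simp: hs_def)
      also have "\<dots> = l (lvl (Suc n) a + lvl (Suc n) b)"
        using lvl(2) ab l_add U by (simp del: psi_lvl.simps)
      finally show "l (lvl (Suc n) (a + b)) = l (lvl (Suc n) a + lvl (Suc n) b)" .
      show "lvl (Suc n) (a + b) \<in> U" "lvl (Suc n) a + lvl (Suc n) b \<in> U"
        using lvl(1)[OF sub[OF ab]] Gam_U add_subgroupD(2)[OF U_subgroup] U by blast+
    qed
  next
    show "strict_mono_on (Gam (Suc n)) (lvl (Suc n))"
    proof (rule strict_mono_onI)
      fix a b assume ab: "a \<in> Gam (Suc n)" "b \<in> Gam (Suc n)" "a < b"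
      have U: "lvl (Suc n) a \<in> U" "lvl (Suc n) b \<in> U" "a \<in> U" "b \<in> U"
        using lvl(1) ab Gam_U by blast+
      have "hless (push (lvl n) (l a)) (push (lvl n) (l b))"
        using hless_push[OF smono l_hs l_hs l_less] ab U by blast
      then show "lvl (Suc n) a < lvl (Suc n) b"
        by (simp only: lvl(2)[OF ab(1), symmetric] lvl(2)[OF ab(2), symmetric] l_less_iff[OF U(1,2)])
    qed
  next
    fix a assume a: "a \<in> Gam (Suc n)"
    \<comment> \<open>The construction pushes with the lower level, while the invariant speaks of
      the same level; they agree because the support of \<open>l a\<close> lies in
      \<open>Gam n\<close>.\<close>
    have "push (lvl n) (l a) = push (lvl (Suc n)) (l a)"
      using lvl_extends[OF Suc] l_hs[OF a] by (intro push_cong) (auto simp: hs_def simp del: psi_lvl.simps)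
    then show "l (lvl (Suc n) a) = push (lvl (Suc n)) (l a)"
      using lvl(2)[OF a] by (simp del: psi_lvl.simps)
  qed
qed

text \<open>The least level in the definition of \<open>psiEL\<close> is only a choice: every level
  containing \<open>a\<close> gives the same value, by \<open>lvl_extends\<close>.\<close>

lemma \<Psi>_eq_lvl:
  assumes "a \<in> Gam n"
  shows "\<Psi> a = lvl n a"
proof -
  let ?m = "LEAST n. a \<in> Gam n"
  have m: "a \<in> Gam ?m" "?m \<le> n"
    using assms by (rule LeastI, rule Least_le)
  have "lvl (?m + k) a = lvl ?m a" for k
  proof (induction k)
    case (Suc k)
    have "a \<in> Gam (?m + k)"
      using m(1) Gam_mono[of ?m "?m + k"] by auto
    then show ?case
      using Suc lvl_extends[OF lvl_embedding] by (simp del: psi_lvl.simps)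
  qed simp
  from this[of "n - ?m"] show ?thesis
    using m(2) by (simp add: psiEL_def)
qed

lemma \<Psi>_G: "a \<in> G \<Longrightarrow> \<Psi> a = \<psi> a"
  using \<Psi>_eq_lvl[of a 0] by (simp add: Gam_0)

lemma \<Psi>_Gam: "a \<in> Gam n \<Longrightarrow> \<Psi> a \<in> Gam n"
  using \<Psi>_eq_lvl[of a n] lvl_embedding[of n] by (auto simp: lvl_embedding_def)

lemma \<Psi>_U: "a \<in> U \<Longrightarrow> \<Psi> a \<in> U"
  using \<Psi>_Gam by (auto simp: UGam_def)

lemma \<Psi>_add: "a \<in> U \<Longrightarrow> b \<in> U \<Longrightarrow> \<Psi> (a + b) = \<Psi> a + \<Psi> b"
proof (erule (1) U_common)
  fix n assume ab: "a \<in> Gam n" "b \<in> Gam n"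
  then show ?thesis
    using \<Psi>_eq_lvl[of _ n] lvl_embedding[of n] add_subgroupD(2)[OF Gam_subgroup ab]
    by (simp add: lvl_embedding_def)
qed

lemma \<Psi>_strict_mono: "strict_mono_on U \<Psi>"
proof (rule strict_mono_onI)
  fix a b assume "a \<in> U" "b \<in> U" and less: "a < b"
  then obtain n where ab: "a \<in> Gam n" "b \<in> Gam n"
    by (meson U_common)
  then show "\<Psi> a < \<Psi> b"
    using \<Psi>_eq_lvl[of _ n] lvl_embedding[of n] less
    by (simp add: lvl_embedding_def monotone_on_def)
qed

lemma \<Psi>_inj: "inj_on \<Psi> U"
  by (rule strict_mono_on_imp_inj_on[OF \<Psi>_strict_mono])

lemma \<Psi>_less_iff: "a \<in> U \<Longrightarrow> b \<in> U \<Longrightarrow> \<Psi> a < \<Psi> b \<longleftrightarrow> a < b"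
  using strict_mono_onD[OF \<Psi>_strict_mono] by (metis less_asym' linorder_neqE)

lemma \<Psi>_0: "\<Psi> 0 = 0"
  using \<Psi>_add[of 0 0] add_subgroupD(1)[OF U_subgroup] by simp

lemma l_\<Psi>: "a \<in> U \<Longrightarrow> l (\<Psi> a) = push \<Psi> (l a)"
proof -
  assume "a \<in> U"
  then obtain n where n: "a \<in> Gam n"
    by (auto simp: UGam_def)
  have "l (\<Psi> a) = push (lvl n) (l a)"
    using \<Psi>_eq_lvl[OF n] lvl_embedding[of n] n by (simp add: lvl_embedding_def)
  also have "\<dots> = push \<Psi> (l a)"
    using l_Gam[OF n] \<Psi>_eq_lvl[of _ n] by (intro push_cong) (auto simp: hs_def pos_part_def)
  finally show ?thesis .
qed

lemma push_\<Psi>_in_hs: "S \<subseteq> U \<Longrightarrow> f \<in> hs S \<Longrightarrow> push \<Psi> f \<in> hs (\<Psi> ` S)"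
  by (rule push_in_hs) (use \<Psi>_strict_mono in \<open>auto simp: monotone_on_def subset_iff\<close>)

lemma ExpGrp_U: "ExpGrp l Gam S \<subseteq> U"
  by (auto simp: ExpGrp_def)

lemma ExpGrp_subgroup: "add_subgroup (ExpGrp l Gam S)"
  unfolding add_subgroup_def ExpGrp_def
  using add_subgroupD[OF U_subgroup] by (auto simp: l_0 l_add l_minus hzero_in_hs hadd_in_hs hneg_in_hs)

text \<open>\<open>ExpGrp\<close> collects elements from all levels, but each such l-value is
  already attained in \<open>Gam (Suc n)\<close>, and \<open>l\<close> is injective on the
  union.\<close>

lemma ExpGrp_Gam:
  assumes "S \<subseteq> pos_part (Gam n)"
  shows "ExpGrp l Gam S \<subseteq> Gam (Suc n)"
proof
  fix c assume "c \<in> ExpGrp l Gam S"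
  then have c: "c \<in> U" "l c \<in> hs (pos_part (Gam n))"
    using hs_mono[OF assms] by (auto simp: ExpGrp_def)
  then obtain c' where "c' \<in> Gam (Suc n)" "l c' = l c"
    using l_surj by blast
  then show "c \<in> Gam (Suc n)"
    using c(1) inj_onD[OF l_inj, of c' c] Gam_U by auto
qed

lemma image_\<Psi>_setplus:
  assumes "A \<subseteq> U" "B \<subseteq> U"
  shows "\<Psi> ` setplus A B = setplus (\<Psi> ` A) (\<Psi> ` B)"
proof -
  have "\<Psi> (a + b) = \<Psi> a + \<Psi> b" if "a \<in> A" "b \<in> B" for a b
    using \<Psi>_add that assms by blast
  then show ?thesis
    unfolding setplus_def by (auto simp: image_iff) metis
qed

lemma image_\<Psi>_above:
  assumes "A \<subseteq> U" "B \<subseteq> U"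
  shows "\<Psi> ` above A B = above (\<Psi> ` A) (\<Psi> ` B)"
  using assms \<Psi>_less_iff by (auto simp: above_def image_iff subset_iff)

lemma image_\<Psi>_pos_part: "A \<subseteq> U \<Longrightarrow> \<Psi> ` pos_part A = pos_part (\<Psi> ` A)"
  using image_\<Psi>_above[of A "{0}"] add_subgroupD(1)[OF U_subgroup] by (simp add: pos_part_eq_above \<Psi>_0)

end

locale EL_automorphism = EL_morphism +
  assumes psi_surj: "psiEL l Gam \<psi> ` UGam Gam = UGam Gam"
begin

lemma image_\<Psi>_ExpGrp:
  assumes S: "S \<subseteq> U"
  shows "\<Psi> ` ExpGrp l Gam S = ExpGrp l Gam (\<Psi> ` S)"
proof
  show "\<Psi> ` ExpGrp l Gam S \<subseteq> ExpGrp l Gam (\<Psi> ` S)"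
    using push_\<Psi>_in_hs[OF S] by (auto simp: ExpGrp_def \<Psi>_U l_\<Psi>)
  show "ExpGrp l Gam (\<Psi> ` S) \<subseteq> \<Psi> ` ExpGrp l Gam S"
  proof
    fix d assume d: "d \<in> ExpGrp l Gam (\<Psi> ` S)"
    then have "d \<in> \<Psi> ` U"
      using psi_surj ExpGrp_U by blast
    then obtain c where c: "c \<in> U" "d = \<Psi> c"
      by blast
    have "\<Psi> ` supp (l c) \<subseteq> \<Psi> ` S"
      using d c by (auto simp: ExpGrp_def l_\<Psi> hs_def supp_push)
    then have "supp (l c) \<subseteq> S"
      using l_supp(1)[OF c(1)] S inj_on_image_mem_iff[OF \<Psi>_inj] by blast
    then have "c \<in> ExpGrp l Gam S"
      using c(1) l_U[OF c(1)] by (auto simp: ExpGrp_def hs_def)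
    then show "d \<in> \<Psi> ` ExpGrp l Gam S"
      using c(2) by blast
  qed
qed

end

subsection \<open>The logarithmic-exponential construction\<close>

locale LE_construction = EL_automorphism G l Gam \<psi>
  for G :: "'g::linordered_ab_group_add set"
    and l :: "'g \<Rightarrow> ('g, 'k::linordered_field) ser"
    and Gam :: "nat \<Rightarrow> 'g set"
    and \<psi> :: "'g \<Rightarrow> 'g" +
  fixes klog :: "'k \<Rightarrow> 'k" and H :: "'g set"
  assumes klog: "surj_klog klog"
    and H_sub: "add_subgroup H" "H \<subseteq> G" "H \<noteq> {0}"
    and growth: "growth_axiom klog l H"
    and preimage: "{\<gamma>\<in>UGam Gam. psiEL l Gam \<psi> \<gamma> \<in> H} \<subseteq> setplus H (ExpGrp l Gam (pos_part H))"
    and lH: "l ` H \<subseteq> hs (\<psi> ` H)"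
begin

abbreviation "gg \<equiv> GG l Gam \<psi> H"

text \<open>The index is shifted by one so that the trivial group of index -1 gets index 0; the two
  successor clauses of \<open>GG\<close> then merge into \<open>gg_Suc\<close>.\<close>

fun pre :: "nat \<Rightarrow> nat \<Rightarrow> 'g set" where
  "pre m 0 = {0}"
| "pre m (Suc n) = gg m n"

abbreviation "fresh m n \<equiv> above (gg m n) (pre m n)"

lemma gg_Suc: "gg m (Suc n) = setplus (gg m n) (ExpGrp l Gam (fresh m n))"
  by (cases n) simp_all

lemma gg_0_G: "gg m 0 \<subseteq> G"
proof (induction m)
  case 0
  then show ?case
    using H_sub by simp
next
  case (Suc m)
  then show ?case
    using morph by (auto simp: morphism_def subset_iff)
qed

lemma gg_Suc_0: "gg (Suc m) 0 = \<Psi> ` gg m 0"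
proof -
  have "gg (Suc m) 0 = \<psi> ` gg m 0"
    by (auto simp: image_iff)
  also have "\<dots> = \<Psi> ` gg m 0"
    using gg_0_G[of m] \<Psi>_G by (intro image_cong) auto
  finally show ?thesis .
qed

lemma gg_U: "gg m n \<subseteq> U"
proof (induction n)
  case 0
  then show ?case
    using gg_0_G[of m] Gam_U[of 0] by (auto simp: Gam_0)
next
  case (Suc n)
  then show ?case
    using ExpGrp_U add_subgroupD(2)[OF U_subgroup] unfolding gg_Suc setplus_def by blast
qed

lemma pre_U: "pre m n \<subseteq> U"
  using gg_U add_subgroupD(1)[OF U_subgroup] by (cases n) auto

lemma fresh_gg: "fresh m n \<subseteq> gg m n"
  by (auto simp: above_def)

lemma gg_Suc_eq_image: "gg (Suc m) n = \<Psi> ` gg m n"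
proof -
  \<comment> \<open>The preceding group is carried along because a fresh layer involves two
    consecutive groups.\<close>
  have "gg (Suc m) n = \<Psi> ` gg m n \<and> pre (Suc m) n = \<Psi> ` pre m n"
  proof (induction n)
    case 0
    then show ?case
      by (simp add: gg_Suc_0 \<Psi>_0 del: GG.simps)
  next
    case (Suc n)
    have "fresh (Suc m) n = \<Psi> ` fresh m n"
      using Suc image_\<Psi>_above[OF gg_U pre_U] by simp
    then have "gg (Suc m) (Suc n) = setplus (\<Psi> ` gg m n) (\<Psi> ` ExpGrp l Gam (fresh m n))"
      using Suc image_\<Psi>_ExpGrp[OF order_trans[OF fresh_gg gg_U]] by (simp add: gg_Suc)
    also have "\<dots> = \<Psi> ` gg m (Suc n)"
      using image_\<Psi>_setplus[OF gg_U ExpGrp_U] by (simp add: gg_Suc)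
    finally show ?case
      using Suc by simp
  qed
  then show ?thesis ..
qed

lemma \<Psi>_minus: "a \<in> U \<Longrightarrow> \<Psi> (- a) = - \<Psi> a"
  using \<Psi>_add[of a "- a"] add_subgroupD(3)[OF U_subgroup] \<Psi>_0
  by (simp add: eq_neg_iff_add_eq_0 add.commute)

lemma image_\<Psi>_subgroup:
  assumes A: "add_subgroup A" "A \<subseteq> U"
  shows "add_subgroup (\<Psi> ` A)"
  unfolding add_subgroup_def
proof (intro conjI ballI)
  show "0 \<in> \<Psi> ` A"
    using add_subgroupD(1)[OF A(1)] \<Psi>_0 by (metis imageI)
  show "x + y \<in> \<Psi> ` A" if "x \<in> \<Psi> ` A" "y \<in> \<Psi> ` A" for x y
    using that A add_subgroupD(2)[OF A(1)] \<Psi>_add by (auto simp: image_iff subset_iff) metis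
  show "- x \<in> \<Psi> ` A" if "x \<in> \<Psi> ` A" for x
    using that A add_subgroupD(3)[OF A(1)] \<Psi>_minus by (auto simp: image_iff subset_iff) metis
qed

lemma gg_subgroup: "add_subgroup (gg m n)"
proof (induction n)
  case 0
  show ?case
  proof (induction m)
    case 0
    then show ?case
      using H_sub by simp
  next
    case (Suc m)
    then show ?case
      using image_\<Psi>_subgroup gg_U unfolding gg_Suc_0 by blast
  qed
next
  case (Suc n)
  then show ?case
    unfolding gg_Suc by (intro setplus_subgroup ExpGrp_subgroup)
qed

lemma gg_incr: "gg m n \<subseteq> gg m (Suc n)"
proof
  fix x assume "x \<in> gg m n"
  then have "x + 0 \<in> setplus (gg m n) (ExpGrp l Gam (fresh m n))"
    by (intro setplusI add_subgroupD(1)[OF ExpGrp_subgroup])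
  then show "x \<in> gg m (Suc n)"
    by (simp add: gg_Suc)
qed

lemma ExpGrp_fresh: "ExpGrp l Gam (fresh m n) \<subseteq> gg m (Suc n)"
proof
  fix c assume "c \<in> ExpGrp l Gam (fresh m n)"
  then have "0 + c \<in> setplus (gg m n) (ExpGrp l Gam (fresh m n))"
    by (intro setplusI add_subgroupD(1)[OF gg_subgroup])
  then show "c \<in> gg m (Suc n)"
    by (simp add: gg_Suc)
qed

lemma fresh_pos: "fresh m n \<subseteq> pos_part (gg m n)"
  using add_subgroupD(1)[OF gg_subgroup] by (cases n) (auto simp: above_def pos_part_def)

lemma gg_Gam: "gg m n \<subseteq> Gam n"
proof (induction n)
  case 0
  then show ?case
    using gg_0_G Gam_0 by simp
next
  case (Suc n)
  have "ExpGrp l Gam (fresh m n) \<subseteq> Gam (Suc n)"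
    using fresh_pos[of m n] pos_part_mono[OF Suc] by (intro ExpGrp_Gam) blast
  then show ?case
    using Suc Gam_Suc[of n] add_subgroupD(2)[OF Gam_subgroup] unfolding gg_Suc setplus_def by blast
qed

section \<open>The growth axiom and convexity for m = 0\<close>

lemma Log_mono: "Log klog l (mono h) = l h"
proof -
  have 0: "infinitesimal (0 :: ('g, 'k) hahn)"
    by (simp add: infinitesimal_def supp_def coef_0)
  have "klog (1 * 1) = klog 1 + klog 1"
    using klog unfolding surj_klog_def using zero_less_one by blast
  then have klog1: "klog 1 = 0"
    by simp
  have ln: "coef (fps_eval (0 :: ('g, 'k) hahn) (fps_ln 1)) x = 0" for x
    by (subst coef_fps_eval_superset[OF 0, of "{}"]) (auto simp: coef_0 fps_ln_nth power_0_left split: if_splits)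
  have "(mono h :: ('g, 'k) ser) = coef (hmon 1 h * (1 + 0))"
    by (simp add: mono_def coef_hmon fun_eq_iff)
  then show ?thesis
    using Log_normal_form[OF 0, of 1 klog l h] by (simp add: klog1 ln hadd_def hconst_def)
qed

lemma fresh_0: "fresh m 0 = pos_part (gg m 0)"
  by (auto simp: above_def pos_part_def)

text \<open>The growth axiom propagated to every step; through \<open>l\<close> it places each new
  infinite exponential above the old group. Nonemptiness belongs to the induction because the step
  compares by way of a monomial of the fresh layer.\<close>

lemma l_gg_less_fresh:
  "(\<forall>x\<in>gg 0 n. \<forall>f\<in>hs (fresh 0 n). hpos f \<longrightarrow> hless (l x) f) \<and> fresh 0 n \<noteq> {}"
proof (induction n)
  case 0
  have "hless (l x) f" if "x \<in> H" "f \<in> hs (pos_part H)" "hpos f" for x f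
  proof -
    have "f \<noteq> hzero"
      using \<open>hpos f\<close> not_hpos_hzero by blast
    then have "hless (Log klog l (mono x)) (habs f)"
      using growth that unfolding growth_axiom_def by blast
    then show ?thesis
      using \<open>hpos f\<close> by (simp add: Log_mono habs_def)
  qed
  moreover have "pos_part H \<noteq> {}"
  proof -
    obtain h where "h \<in> H" "h \<noteq> 0"
      using H_sub add_subgroupD(1)[OF H_sub(1)] by blast
    then have "h \<in> pos_part H \<or> - h \<in> pos_part H"
      using add_subgroupD(3)[OF H_sub(1)] by (auto simp: pos_part_def)
    then show ?thesis
      by blast
  qed
  ultimately show ?case
    unfolding fresh_0 by simp
next
  case (Suc n)
  \<comment> \<open>The monomial \<open>u\<close> mediates: by induction it exceeds
    \<open>l y\<close> for all \<open>y\<close> in \<open>gg 0 n\<close>, and series over the next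
    fresh layer dominate it. The claim is then f - l x = (f - l c - u) + (u - l y) with both
    brackets positive.\<close>
  then obtain u where u: "u \<in> fresh 0 n"
    by blast
  let ?u = "mono u :: ('g, 'k) ser"
  have mono_u: "?u \<in> hs (fresh 0 n)"
    using u by (rule mono_in_hs)
  have less_u: "hless (l y) ?u" if "y \<in> gg 0 n" for y
    using Suc that mono_u hpos_mono by blast
  have "hless (l x) f" if x: "x \<in> gg 0 (Suc n)" and f: "f \<in> hs (fresh 0 (Suc n))" "hpos f" for x f
  proof -
    obtain y c where yc: "x = y + c" "y \<in> gg 0 n" "c \<in> ExpGrp l Gam (fresh 0 n)"
      using x unfolding gg_Suc setplus_def by blast
    have yU: "y \<in> U" and cU: "c \<in> U"
      using yc gg_U ExpGrp_U by blast+
    have lc: "l c \<in> hs (gg 0 n)"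
      using yc(3) hs_mono[OF fresh_gg] by (auto simp: ExpGrp_def)
    obtain m where m: "0 < f m" "\<And>z. m < z \<Longrightarrow> f z = 0"
      using f by (auto simp: hs_def elim: hposE)
    have above: "z < m" if "z \<in> gg 0 n" for z
    proof -
      have "m \<in> fresh 0 (Suc n)"
        using f(1) m(1) by (auto simp: hs_def supp_def)
      then show ?thesis
        using that by (simp add: above_def)
    qed
    \<comment> \<open>The exponents of \<open>l c\<close> and of \<open>u\<close> lie in
      \<open>gg 0 n\<close>, hence below the leading exponent \<open>m\<close> of \<open>f\<close>;
      subtracting them leaves the leading term of \<open>f\<close> untouched.\<close>
    have low: "l c z = 0" "?u z = 0" if "m \<le> z" for z
    proof -
      have "z \<notin> gg 0 n"
        using above[of z] that by auto
      then show "l c z = 0" "?u z = 0"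
        using lc u fresh_gg by (auto simp: hs_def supp_def mono_def)
    qed
    have 1: "hpos (hsub (hsub f (l c)) ?u)"
      using m low by (intro hposI[of _ m]) (auto simp: hsub_def)
    have 2: "hpos (hsub ?u (l y))"
      using less_u[OF yc(2)] by (simp add: hless_def)
    have UU: "f \<in> hs U" "l c \<in> hs U" "?u \<in> hs U" "l y \<in> hs U"
      using f(1) lc mono_u l_U[OF yU] hs_mono[OF gg_U] hs_mono[OF order_trans[OF fresh_gg gg_U]]
        hs_mono[of "pos_part U" U]
      by (blast, blast, blast, auto simp: pos_part_def)
    have "hsub (hsub f (l c)) ?u \<in> hs U" "hsub ?u (l y) \<in> hs U"
      by (intro hsub_in_hs UU)+
    then have "hpos (hadd (hsub (hsub f (l c)) ?u) (hsub ?u (l y)))"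
      using 1 2 by (intro hpos_hadd) (auto simp: hs_def)
    moreover have "hadd (hsub (hsub f (l c)) ?u) (hsub ?u (l y)) = hsub f (l x)"
      using l_add[OF yU cU] yc(1) by (simp add: fun_eq_iff hadd_def hsub_def)
    ultimately show ?thesis
      by (simp add: hless_def)
  qed
  \<comment> \<open>The witness is the exponential of the monomial \<open>u\<close>: all l-values of
    \<open>gg 0 n\<close> are below \<open>u\<close>, so the whole group is below e(u).\<close>
  moreover have "fresh 0 (Suc n) \<noteq> {}"
  proof -
    have "?u \<in> hs (pos_part (Gam n))"
      using mono_u hs_mono[OF fresh_pos] hs_mono[OF pos_part_mono[OF gg_Gam]] by blast
    then obtain c where c: "c \<in> Gam (Suc n)" "l c = ?u"
      using l_surj by blast
    then have cU: "c \<in> U"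
      using Gam_U by blast
    then have "c \<in> ExpGrp l Gam (fresh 0 n)"
      using c(2) mono_u by (simp add: ExpGrp_def)
    then have "c \<in> gg 0 (Suc n)"
      using ExpGrp_fresh by blast
    moreover have "y < c" if "y \<in> gg 0 n" for y
      using less_u[OF that] c(2) l_less_iff[of y c] that gg_U cU by auto
    ultimately have "c \<in> fresh 0 (Suc n)"
      by (simp add: above_def)
    then show ?thesis
      by blast
  qed
  ultimately show ?case
    by blast
qed

text \<open>By the growth axiom, each step of the construction has the previous one as a convex
  subgroup.\<close>

lemma pos_part_gg_Suc: "pos_part (gg 0 (Suc n)) \<subseteq> pos_part (gg 0 n) \<union> fresh 0 (Suc n)"
proof
  fix x assume "x \<in> pos_part (gg 0 (Suc n))"
  then have x: "x \<in> gg 0 (Suc n)" "0 < x"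
    by (auto simp: pos_part_def)
  obtain y c where yc: "x = y + c" "y \<in> gg 0 n" "c \<in> ExpGrp l Gam (fresh 0 n)"
    using x(1) unfolding gg_Suc setplus_def by blast
  have cU: "c \<in> U"
    using yc ExpGrp_U by blast
  have lc: "l c \<in> hs (fresh 0 n)"
    using yc(3) by (simp add: ExpGrp_def)
  \<comment> \<open>Translated back through \<open>l\<close>: an exponential of a positive series
    over the fresh layer exceeds the whole group. The sign of \<open>l c\<close> therefore decides
    where \<open>y + c\<close> lies.\<close>
  have less: "z < d" if "z \<in> gg 0 n" "d \<in> U" "l d \<in> hs (fresh 0 n)" "hpos (l d)" for z d
    using l_gg_less_fresh[of n] that l_less_iff[of z d] gg_U by blast
  consider "l c = hzero" | "hpos (l c)" | "hpos (hneg (l c))"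
    using hpos_or_hpos_hneg[of "l c"] lc by (auto simp: hs_def)
  then show "x \<in> pos_part (gg 0 n) \<union> fresh 0 (Suc n)"
  proof cases
    case 1
    then have "c = 0"
      using inj_onD[OF l_inj, of c 0] cU l_0 add_subgroupD(1)[OF U_subgroup] by simp
    then show ?thesis
      using yc x by (simp add: pos_part_def)
  next
    case 2
    have "z < x" if "z \<in> gg 0 n" for z
      using less[OF add_subgroupD(4)[OF gg_subgroup that yc(2)] cU lc 2] yc(1)
      by (simp add: algebra_simps)
    then show ?thesis
      using x(1) by (simp add: above_def)
  next
    case 3
    have "y < - c"
      using less[OF yc(2), of "- c"] 3 l_minus[OF cU] hneg_in_hs[OF lc]
        add_subgroupD(3)[OF U_subgroup cU] by simp
    then have "x < 0"
      using yc(1) by (simp add: less_minus_iff less_diff_eq[symmetric])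
    then show ?thesis
      using x(2) by simp
  qed
qed

lemma ExpGrp_pos_part_0: "ExpGrp l Gam (pos_part (gg 0 n)) \<subseteq> gg 0 (Suc n)"
proof (induction n)
  case 0
  then show ?case
    using ExpGrp_fresh[of 0 0] unfolding fresh_0 .
next
  case (Suc n)
  show ?case
  proof
    fix c assume "c \<in> ExpGrp l Gam (pos_part (gg 0 (Suc n)))"
    then have c: "c \<in> U" "l c \<in> hs (pos_part (gg 0 (Suc n)))"
      by (auto simp: ExpGrp_def)
    let ?T = "fresh 0 (Suc n)"
    \<comment> \<open>The part of \<open>l c\<close> over the top layer has its exponential
      \<open>d\<close> in the next group by construction. By convexity the remaining exponents lie
      in \<open>gg 0 n\<close>, so the induction hypothesis handles \<open>c - d\<close>.\<close>
    have f1: "hrestrict ?T (l c) \<in> hs ?T"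
      using hrestrict_in_hs[OF c(2), of ?T] hs_mono[of "pos_part (gg 0 (Suc n)) \<inter> ?T" ?T] by auto
    then have "hrestrict ?T (l c) \<in> hs (pos_part (Gam (Suc n)))"
      using hs_mono[OF fresh_pos] hs_mono[OF pos_part_mono[OF gg_Gam]] by blast
    then obtain d where d: "d \<in> Gam (Suc (Suc n))" "l d = hrestrict ?T (l c)"
      using l_surj by blast
    have dU: "d \<in> U" "- d \<in> U"
      using d(1) Gam_U add_subgroupD(3)[OF U_subgroup] by blast+
    have "d \<in> ExpGrp l Gam ?T"
      using dU(1) f1 d(2) by (simp add: ExpGrp_def)
    then have 1: "d \<in> gg 0 (Suc (Suc n))"
      using ExpGrp_fresh by blast
    have "l (c + - d) = hrestrict (- ?T) (l c)"
      using l_add[OF c(1) dU(2)] l_minus[OF dU(1)] d(2)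
      by (simp add: fun_eq_iff hadd_def hneg_def hrestrict_def)
    moreover have "hrestrict (- ?T) (l c) \<in> hs (pos_part (gg 0 n))"
      using hrestrict_in_hs[OF c(2), of "- ?T"] pos_part_gg_Suc[of n]
        hs_mono[of "pos_part (gg 0 (Suc n)) \<inter> - ?T" "pos_part (gg 0 n)"] by blast
    ultimately have "c + - d \<in> ExpGrp l Gam (pos_part (gg 0 n))"
      using add_subgroupD(2)[OF U_subgroup c(1) dU(2)] by (simp add: ExpGrp_def)
    then have 2: "c + - d \<in> gg 0 (Suc (Suc n))"
      using Suc gg_incr by blast
    show "c \<in> gg 0 (Suc (Suc n))"
      using add_subgroupD(2)[OF gg_subgroup 2 1] by simp
  qed
qed

text \<open>Growth is available only for m = 0, so the general case is transported along
  \<Psi>.\<close>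

lemma ExpGrp_pos_part: "ExpGrp l Gam (pos_part (gg m n)) \<subseteq> gg m (Suc n)"
proof (induction m)
  case 0
  then show ?case
    by (rule ExpGrp_pos_part_0)
next
  case (Suc m)
  have "ExpGrp l Gam (pos_part (gg (Suc m) n)) = \<Psi> ` ExpGrp l Gam (pos_part (gg m n))"
    using gg_U[of m n] image_\<Psi>_pos_part[OF gg_U, of m n]
    by (subst image_\<Psi>_ExpGrp) (auto simp: gg_Suc_eq_image pos_part_def)
  then show ?case
    using Suc by (auto simp: gg_Suc_eq_image)
qed

text \<open>The preimage of the exponential factor has its l-support somewhere in
  \<open>gg 0 (Suc n)\<close>, not in a known layer. The defining step of the construction does not
  cover it, but \<open>ExpGrp_pos_part_0\<close> does.\<close>

lemma \<Psi>_preimage_gg: "x \<in> U \<Longrightarrow> \<Psi> x \<in> gg 0 n \<Longrightarrow> x \<in> gg 0 (Suc n)"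
proof (induction n arbitrary: x)
  case 0
  then have "x \<in> setplus H (ExpGrp l Gam (pos_part H))"
    using preimage by auto
  then show ?case
    unfolding gg_Suc fresh_0 by simp
next
  case (Suc n)
  obtain y c where yc: "\<Psi> x = y + c" "y \<in> gg 0 n" "c \<in> ExpGrp l Gam (fresh 0 n)"
    using Suc.prems(2) unfolding gg_Suc setplus_def by blast
  have "y \<in> \<Psi> ` U" "c \<in> \<Psi> ` U"
    using yc gg_U ExpGrp_U unfolding psi_surj by blast+
  then obtain y' c' where y': "y' \<in> U" "y = \<Psi> y'" and c': "c' \<in> U" "c = \<Psi> c'"
    by blast
  have "\<Psi> x = \<Psi> (y' + c')"
    using yc(1) y' c' by (simp only: \<Psi>_add)
  then have "x = y' + c'"
    using inj_onD[OF \<Psi>_inj] Suc.prems(1) add_subgroupD(2)[OF U_subgroup y'(1) c'(1)] by blast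
  moreover have "y' \<in> gg 0 (Suc (Suc n))"
    using Suc.IH[OF y'(1)] yc(2) y'(2) gg_incr by blast
  moreover have "c' \<in> gg 0 (Suc (Suc n))"
  proof -
    \<comment> \<open>The induction hypothesis is used a second time, now for the individual
      exponents in the support of \<open>l c'\<close>.\<close>
    have "\<Psi> ` supp (l c') \<subseteq> fresh 0 n"
      using yc(3) c' by (simp add: ExpGrp_def hs_def l_\<Psi> supp_push)
    then have "\<Psi> ` supp (l c') \<subseteq> gg 0 n"
      using fresh_gg by blast
    then have "supp (l c') \<subseteq> gg 0 (Suc n)"
      using Suc.IH l_supp(1)[OF c'(1)] by blast
    then have "supp (l c') \<subseteq> pos_part (gg 0 (Suc n))"
      using l_supp(2)[OF c'(1)] by (auto simp: pos_part_def)
    then have "c' \<in> ExpGrp l Gam (pos_part (gg 0 (Suc n)))"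
      using c'(1) l_U[OF c'(1)] by (auto simp: ExpGrp_def hs_def)
    then show ?thesis
      using ExpGrp_pos_part_0 by blast
  qed
  ultimately show ?case
    using add_subgroupD(2)[OF gg_subgroup] by blast
qed

text \<open>For m = 0 write x = \<Psi> y: the preimage y lies in \<open>gg 0 (Suc n)\<close>, and
  applying \<Psi> again lands in the groups for m = 1. Further applications of \<Psi> give all
  m.\<close>

lemma gg_shift: "gg m n \<subseteq> gg (Suc m) (Suc n)"
proof (induction m)
  case 0
  show ?case
  proof
    fix x assume x: "x \<in> gg 0 n"
    then have "x \<in> \<Psi> ` U"
      using gg_U psi_surj by blast
    then obtain y where "y \<in> U" "x = \<Psi> y"
      by blast
    then show "x \<in> gg (Suc 0) (Suc n)"
      using \<Psi>_preimage_gg x by (auto simp: gg_Suc_eq_image)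
  qed
next
  case (Suc m)
  then show ?case
    unfolding gg_Suc_eq_image[of "Suc m"] gg_Suc_eq_image[of m n] by (rule image_mono)
qed

lemma l_gg: "l ` gg m n \<subseteq> hs (gg (Suc m) (Suc n))"
proof (induction m)
  case 0
  show ?case
  proof (induction n)
    case 0
    have "hs (gg (Suc 0) 0) \<subseteq> hs (gg (Suc 0) (Suc 0))"
      by (rule hs_mono[OF gg_incr])
    then show ?case
      using lH by auto
  next
    case (Suc n)
    show ?case
    proof
      fix f assume "f \<in> l ` gg 0 (Suc n)"
      then obtain y c where yc: "f = l (y + c)" "y \<in> gg 0 n" "c \<in> ExpGrp l Gam (fresh 0 n)"
        unfolding gg_Suc setplus_def by blast
      have "l y \<in> hs (gg (Suc 0) (Suc (Suc n)))"
        using Suc yc(2) hs_mono[OF gg_incr] by blast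
      moreover have "l c \<in> hs (gg (Suc 0) (Suc (Suc n)))"
      proof -
        have "fresh 0 n \<subseteq> gg (Suc 0) (Suc (Suc n))"
          using fresh_gg gg_shift gg_incr by blast
        then show ?thesis
          using yc(3) hs_mono by (auto simp: ExpGrp_def)
      qed
      ultimately show "f \<in> hs (gg (Suc 0) (Suc (Suc n)))"
        using yc gg_U ExpGrp_U l_add by (auto simp: subset_iff intro!: hadd_in_hs)
    qed
  qed
next
  case (Suc m)
  show ?case
  proof
    fix f assume "f \<in> l ` gg (Suc m) n"
    then obtain x where x: "x \<in> gg m n" "f = l (\<Psi> x)"
      unfolding gg_Suc_eq_image by blast
    then have "f = push \<Psi> (l x)"
      using l_\<Psi> gg_U by blast
    moreover have "l x \<in> hs (gg (Suc m) (Suc n))"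
      using Suc x(1) by blast
    ultimately show "f \<in> hs (gg (Suc (Suc m)) (Suc n))"
      using push_\<Psi>_in_hs[OF gg_U] unfolding gg_Suc_eq_image[of "Suc m"] by blast
  qed
qed

lemma gg_diag: "gg m n \<subseteq> gg (m + k) (n + k + j)"
proof -
  have "gg m n \<subseteq> gg (m + k) (n + k)"
  proof (induction k)
    case (Suc k)
    then show ?case
      using gg_shift[of "m + k" "n + k"] by auto
  qed simp
  moreover have "gg (m + k) (n + k) \<subseteq> gg (m + k) (n + k + j)"
  proof (induction j)
    case (Suc j)
    then show ?case
      using gg_incr[of "m + k" "n + k + j"] by auto
  qed simp
  ultimately show ?thesis
    by blast
qed

section \<open>The union over all m and its closure properties\<close>

abbreviation "LEH \<equiv> LE l Gam \<psi> H"

lemma Lm_mono: "Lm l Gam \<psi> H m \<subseteq> Lm l Gam \<psi> H (Suc m)"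
  unfolding Lm_def using hs_mono[OF gg_shift] by blast

lemma hs_gg_LE: "hs (gg m n) \<subseteq> LEH"
  by (auto simp: LE_def Lm_def)

lemma LE_common:
  assumes "f \<in> LEH" "g \<in> LEH"
  obtains m n where "f \<in> hs (gg m n)" "g \<in> hs (gg m n)"
proof -
  obtain m n m' n' where f: "f \<in> hs (gg m n)" and g: "g \<in> hs (gg m' n')"
    using assms by (auto simp: LE_def Lm_def)
  \<comment> \<open>To reach the common index \<open>m + m'\<close>, the first group is shifted
    \<open>m'\<close> times and the second \<open>m\<close> times, which raises n by as much;
    \<open>?N\<close> bounds both results.\<close>
  let ?N = "n + m' + n' + m"
  have "gg m n \<subseteq> gg (m + m') (n + m' + (n' + m))" "gg m' n' \<subseteq> gg (m' + m) (n' + m + (n + m'))"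
    by (rule gg_diag)+
  then have "gg m n \<subseteq> gg (m + m') ?N" "gg m' n' \<subseteq> gg (m + m') ?N"
    by (simp_all add: ac_simps)
  then show thesis
    using that f g hs_mono by blast
qed

lemma LE_KEL: "LEH \<subseteq> KEL Gam"
  unfolding LE_def Lm_def KEL_def using hs_mono[OF gg_Gam] by blast

lemma subfield_LE: "subfield_EL Gam LEH"
  unfolding subfield_EL_def
proof (intro conjI ballI impI)
  show "LEH \<subseteq> KEL Gam"
    by (rule LE_KEL)
  show "hzero \<in> LEH"
    using hzero_in_hs hs_gg_LE by blast
  show "hone \<in> LEH"
    unfolding hone_def using hconst_in_hs[OF add_subgroupD(1)[OF gg_subgroup]] hs_gg_LE by blast
next
  fix f g assume "f \<in> LEH" "g \<in> LEH"
  then obtain m n where "f \<in> hs (gg m n)" "g \<in> hs (gg m n)"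
    by (rule LE_common)
  then have "hadd f g \<in> hs (gg m n)" "hsub f g \<in> hs (gg m n)" "hmul f g \<in> hs (gg m n)"
    by (rule hadd_in_hs, rule hsub_in_hs, rule hmul_in_hs[OF gg_subgroup])
  then show "hadd f g \<in> LEH" "hsub f g \<in> LEH" "hmul f g \<in> LEH"
    using hs_gg_LE by blast+
next
  fix f assume "f \<in> LEH" "f \<noteq> hzero"
  then obtain m n where "f \<in> hs (gg m n)"
    by (auto simp: LE_def Lm_def)
  then obtain g where "g \<in> hs (gg m n)" "hmul f g = hone"
    using hs_inverse[OF gg_subgroup] \<open>f \<noteq> hzero\<close> by blast
  then show "\<exists>g\<in>LEH. hmul f g = hone"
    using hs_gg_LE by blast
qed

lemma Log_LE:
  assumes "f \<in> LEH" "hpos f"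
  shows "Log klog l f \<in> LEH"
proof -
  obtain m n where "f \<in> hs (gg m n)"
    using assms(1) by (auto simp: LE_def Lm_def)
  then have "Log klog l f \<in> hs (gg (Suc m) (Suc n))"
    using Log_in_hs[OF gg_subgroup _ assms(2) gg_shift l_gg] by blast
  then show ?thesis
    using hs_gg_LE by blast
qed

lemma Log_inj_KEL:
  assumes "f \<in> KEL Gam" "f' \<in> KEL Gam" "hpos f" "hpos f'" "Log klog l f = Log klog l f'"
  shows "f = f'"
proof -
  obtain i j where "f \<in> hs (Gam i)" "f' \<in> hs (Gam j)"
    using assms(1,2) by (auto simp: KEL_def)
  then have "f \<in> hs U" "f' \<in> hs U"
    using hs_mono[OF Gam_U] by blast+
  then show ?thesis
    using Log_inj[OF klog U_subgroup l_inj l_supp(2)] assms(3-) by blast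
qed

text \<open>The purely infinite part of \<open>f\<close> has its exponential in
  \<open>gg m (Suc n)\<close> by \<open>ExpGrp_pos_part\<close>, so \<open>Log_surj\<close> gives a
  preimage over that group. Since \<open>Exp\<close> ranges over the whole EL field,
  \<open>Log_inj_KEL\<close> is needed to identify the two.\<close>

lemma Exp_LE:
  assumes "f \<in> LEH"
  shows "Exp klog l Gam f \<in> LEH"
proof -
  obtain m n where f: "f \<in> hs (gg m n)"
    using assms by (auto simp: LE_def Lm_def)
  have eq: "gg m n \<inter> {0<..} = pos_part (gg m n)"
    by (auto simp: pos_part_def)
  have r: "hrestrict {0<..} f \<in> hs (pos_part (gg m n))"
    using hrestrict_in_hs[OF f, of "{0<..}"] by (simp only: eq)
  then have "hrestrict {0<..} f \<in> hs (pos_part (Gam n))"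
    using hs_mono[OF pos_part_mono[OF gg_Gam]] by blast
  then obtain c where c: "c \<in> Gam (Suc n)" "l c = hrestrict {0<..} f"
    using l_surj by blast
  then have "c \<in> ExpGrp l Gam (pos_part (gg m n))"
    using r Gam_U by (auto simp: ExpGrp_def)
  then have cg: "c \<in> gg m (Suc n)"
    using ExpGrp_pos_part by blast
  have "f \<in> hs (gg m (Suc n))"
    using f hs_mono[OF gg_incr] by blast
  then obtain h where h: "h \<in> hs (gg m (Suc n))" "hpos h" "Log klog l h = f"
    using Log_surj[of klog "gg m (Suc n)" f c l, OF klog gg_subgroup _ cg c(2)] by blast
  have hLE: "h \<in> LEH"
    using h(1) hs_gg_LE by blast
  have "Exp klog l Gam f = h"
    unfolding Exp_def
  proof (rule the_equality)
    show "h \<in> KEL Gam \<and> hpos h \<and> Log klog l h = f"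
      using h hLE LE_KEL by blast
    show "h' = h" if "h' \<in> KEL Gam \<and> hpos h' \<and> Log klog l h' = f" for h'
      using that h hLE LE_KEL Log_inj_KEL by blast
  qed
  then show ?thesis
    using hLE by simp
qed

lemma push_LE:
  assumes "f \<in> LEH"
  shows "push \<Psi> f \<in> LEH"
proof -
  obtain m n where f: "f \<in> hs (gg m n)"
    using assms by (auto simp: LE_def Lm_def)
  then have "push \<Psi> f \<in> hs (gg (Suc m) n)"
    unfolding gg_Suc_eq_image by (rule push_\<Psi>_in_hs[OF gg_U])
  then show ?thesis
    using hs_gg_LE by blast
qed

lemma hs_H_LE: "hs H \<subseteq> LEH"
  using hs_gg_LE[of 0 0] by simp

end

theorem theorem9:
  fixes klog :: "'k::linordered_field \<Rightarrow> 'k"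
    and G H :: "'g::linordered_ab_group_add set"
    and l :: "'g \<Rightarrow> ('g, 'k) ser"
    and Gam :: "nat \<Rightarrow> 'g set"
    and \<psi> :: "'g \<Rightarrow> 'g"
  assumes klog: "surj_klog klog"
    and tower: "EL_tower G l Gam"
    and morph: "morphism G l \<psi>"
    and H_sub: "add_subgroup H" "H \<subseteq> G" "H \<noteq> {0}"
    and growth: "growth_axiom klog l H"
    and psi_surj: "psiEL l Gam \<psi> ` UGam Gam = UGam Gam"
    and preimage: "{\<gamma>\<in>UGam Gam. psiEL l Gam \<psi> \<gamma> \<in> H} \<subseteq> setplus H (ExpGrp l Gam (pos_part H))"
    and lH: "l ` H \<subseteq> hs (\<psi> ` H)"
  shows "(\<forall>m. Lm l Gam \<psi> H m \<subseteq> Lm l Gam \<psi> H (Suc m)) \<and>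
         subfield_EL Gam (LE l Gam \<psi> H) \<and>
         hs H \<subseteq> LE l Gam \<psi> H \<and>
         (\<forall>\<beta>\<in>LE l Gam \<psi> H. Exp klog l Gam \<beta> \<in> LE l Gam \<psi> H) \<and>
         (\<forall>\<alpha>\<in>LE l Gam \<psi> H. hpos \<alpha> \<longrightarrow> Log klog l \<alpha> \<in> LE l Gam \<psi> H) \<and>
         (\<forall>f\<in>LE l Gam \<psi> H. push (psiEL l Gam \<psi>) f \<in> LE l Gam \<psi> H)"
proof -
  interpret LE_construction G l Gam \<psi> klog H
    by unfold_locales (fact assms)+
  show ?thesis
    using Lm_mono subfield_LE hs_H_LE Exp_LE Log_LE push_LE by blast
qed

end
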